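(* Let $(X_1^{(1)},\ldots,X_{k_1}^{(1)};\ldots;X_1^{(n)},\ldots,X_{k_n}^{(n)})\sim SME_\zeta(\boldsymbol{\beta},\underline{\boldsymbol{Q}},\boldsymbol{\alpha})$ with $\gamma_j^{(i)}<\infty$ and $\beta_{k_n}^{(n)}\ge\beta_j^{(i)}$ for $i\in I_n$, $j=1,\ldots,k_i$. Let $d_i>0$, $i\in I_n$, let $S_i=\sum_{j=1}^{k_i}X_j^{(i)}$, $T_i=(S_i-d_i)_+$, $R_n=\sum_{i=1}^nT_i$, let $p\in(0,1)$ and $x_p:=VaR_p(R_n)$. Then for each $l\in I_n$ the capital allocated to portfolio $l$ under the TVaR rule, $C_l(p)=\frac{1}{1-p}\mathbb{E}\big(T_l\mathbb{1}_{\{R_n>x_p\}}\big)$, is $$\begin{aligned}C_l(p)=\frac1{1-p}\sum_{k=0}^{n-1}\ \sum_{\substack{1\le j_1<\cdots<j_k\le n\\ l\notin\{j_1,\ldots,j_k\}}}\Big[&\xi_nU_{\sum_{i=1}^kS_{j_i}^{(1)},S_l^{(1)}}(x_p,d_{j_1},\ldots,d_{j_k},d_l)\prod_{i\in I_n\setminus\{j_1,\ldots,j_k,l\}}F_{S_i^{(1)}}(d_i)\\ &-\sum_{1\le a\le b\le n}\sum_{s=1}^{k_a}\sum_{t=T(s,a,b)}^{k_b}\alpha_{s,t}^{(a,b)}\gamma_s^{(a)}\gamma_t^{(b)}\Big(U_{\sum_{i=1}^kS_{j_i;s}^{(2;a)},S_{l;s}^{(2;a)}}(x_p,d_{j_1},\ldots,d_{j_k},d_l)\prod_{i\in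 I_n\setminus\{j_1,\ldots,j_k,l\}}F_{S_{i;s}^{(2;a)}}(d_i)\\ &\quad+U_{\sum_{i=1}^kS_{j_i;t}^{(2;b)},S_{l;t}^{(2;b)}}(x_p,d_{j_1},\ldots,d_{j_k},d_l)\prod_{i\in I_n\setminus\{j_1,\ldots,j_k,l\}}F_{S_{i;t}^{(2;b)}}(d_i)\\ &\quad-U_{\sum_{i=1}^kS_{j_i;s,t}^{(3;a,b)},S_{l;s,t}^{(3;a,b)}}(x_p,d_{j_1},\ldots,d_{j_k},d_l)\prod_{i\in I_n\setminus\{j_1,\ldots,j_k,l\}}F_{S_{i;s,t}^{(3;a,b)}}(d_i)\Big)\Big],\end{aligned}$$ where, by convention, for $k=0$ the inner sum over $j_1<\cdots<j_k$ consists of a single term, in which each component of the type $U_{\sum_{i=1}^kS_{j_i},S_l}(x_p,d_{j_1},\ldots,d_{j_k},d_l)$ is replaced with $U_{S_l}(x_p,d_l)$.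
   Context: $VaR_p(Z)=\min\{x: F_Z(x)\ge p\}$; $F_Z$ is the distribution function of $Z$; $I_n=\{1,\ldots,n\}$; $\mathbb{1}$ denotes an indicator; empty products equal $1$, empty sums equal $0$. Mixed Erlang: for $\beta>0$, $k\ge1$, $w_k(x,\beta)=\frac{\beta^kx^{k-1}e^{-\beta x}}{(k-1)!}$, $x\ge0$, and $\overline{W}_k(x,\beta)=e^{-\beta x}\sum_{j=0}^{k-1}\frac{(\beta x)^j}{j!}$. $ME(\beta,\underline{Q})$, with $\underline{Q}=(q_1,q_2,\ldots)$, $q_k\ge0$, $\sum_kq_k=1$, is the distribution on $[0,\infty)$ with pdf $\sum_{k\ge1}q_kw_k(x,\beta)$. Model $SME_\zeta(\boldsymbol{\beta},\underline{\boldsymbol{Q}},\boldsymbol{\alpha})$: $n\ge 1$, $k_1,\ldots,k_n\ge1$ are integers, $\zeta=\sum_{i=1}^nk_i$, $\boldsymbol\beta=(\beta_j^{(i)})$, $\underline{\boldsymbol{Q}}=(\underline{Q}_j^{(i)})$, and $X_j^{(i)}\sim ME(\beta_j^{(i)},\underline{Q}_j^{(i)})$ with pdf $f_j^{(i)}$. Put $\gamma_j^{(i)}=\mathbb{E}(f_j^{(i)}(X_j^{(i)}))$ and $\phi_j^{(i)}(x)=f_j^{(i)}(x)-\gamma_j^{(i)}$. The joint pdf is the Sarmanov density $$h(\boldsymbol{x})=\prod_{i=1}^n\prod_{j=1}^{k_i}f_j^{(i)}(x_j^{(i)})\Big[1+\sum_{1\le a<b\le n}\sum_{s=1}^{k_a}\sum_{t=1}^{k_b}\alpha_{s,t}^{(a,b)}\phi_s^{(a)}(x_s^{(a)})\phi_t^{(b)}(x_t^{(b)})+\sum_{a=1}^n\sum_{1\le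 s<t\le k_a}\alpha_{s,t}^{(a)}\phi_s^{(a)}(x_s^{(a)})\phi_t^{(a)}(x_t^{(a)})\Big],$$ where $\boldsymbol\alpha$ collects the real coefficients, which are such that the bracket is nonnegative. Write $\alpha_{s,t}^{(a,a)}=\alpha_{s,t}^{(a)}$, $T(s,a,b)=\max\{1,(s+1)\mathbb{1}_{(a=b)}\}$, and $$\xi_n=1+\sum_{1\le a\le b\le n}\sum_{s=1}^{k_a}\sum_{t=T(s,a,b)}^{k_b}\alpha_{s,t}^{(a,b)}\gamma_s^{(a)}\gamma_t^{(b)}.$$ Transformations of mixing vectors: - $V(\underline{Q})=(v_1,v_2,\ldots)$, $v_k=\dfrac{\sum_{i=1}^k\binom{k-1}{i-1}q_iq_{k+1-i}/2^k}{\sum_{i\ge1}\sum_{j\ge1}\binom{i+j-2}{i-1}q_iq_j/2^{i+j-1}}$; $V$ changes the associated scale parameter from $\beta$ to $2\beta$. - $\Psi(\underline{Q})=(\psi_1,\psi_2,\ldots)$ converts a scale $\beta_1$ into a scale $\beta_2\ge\beta_1$: $\psi_k=\sum_{i=1}^kq_i\binom{k-1}{k-i}\big(\frac{\beta_1}{\beta_2}\big)^i\big(1-\frac{\beta_1}{\beta_2}\big)^{k-i}$ (with $0^0=1$). Here the target is always $\beta_2=2\beta_{k_n}^{(n)}$, and the source scale is $\beta_1=\beta_l^{(j)}$ when $\Psi$ is applied to $\underline{Q}_l^{(j)}$ and $\beta_1=2\beta_l^{(j)}$ when it is applied to $V(\underline{Q}_l^{(j)})$. - $\underline{\Pi}(\underline{Q}_1,\ldots,\underline{Q}_m)=(\pi_1,\pi_2,\ldots)$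 is defined iteratively: $\underline{\Pi}(\underline{Q}_1)=\underline{Q}_1$, and $\pi_l(\underline{Q}_1,\ldots,\underline{Q}_{m+1})=0$ for $l=1,\ldots,m$, $\pi_l(\underline{Q}_1,\ldots,\underline{Q}_{m+1})=\sum_{j=m}^{l-1}\pi_j(\underline{Q}_1,\ldots,\underline{Q}_m)\,q_{m+1,l-j}$ for $l\ge m+1$, where $\underline{Q}_i=(q_{i,1},q_{i,2},\ldots)$. Auxiliary variables (only their distributions matter): with $M_{s,t}^{(a,b)}(\underline{Q}_l^{(j)})=V(\underline{Q}_l^{(j)})$ if $(j,l)\in\{(a,s),(b,t)\}$ and $=\underline{Q}_l^{(j)}$ otherwise, $$S_j^{(1)}\sim ME\big(2\beta_{k_n}^{(n)},\underline{\Pi}(\Psi(\underline{Q}_1^{(j)}),\ldots,\Psi(\underline{Q}_{k_j}^{(j)}))\big),\quad S_{j;s,t}^{(3;a,b)}\sim ME\big(2\beta_{k_n}^{(n)},\underline{\Pi}(\Psi(M_{s,t}^{(a,b)}(\underline{Q}_1^{(j)})),\ldots,\Psi(M_{s,t}^{(a,b)}(\underline{Q}_{k_j}^{(j)})))\big),\quad S_{j;s}^{(2;a)}=S_{j;s,s}^{(3;a,a)}.$$ The functions $U$: for $Z_i\sim ME(\beta,\underline{P}_i)$, $i=1,\ldots,k+1$, with common scale $\beta$, $d_i>0$ and $y\ge0$, $$U_{\sum_{i=1}^kZ_i,Z_{k+1}}(y,d_1,\ldots,d_{k+1})=\frac1\beta\sum_{h_1=0}^\infty\cdots\sum_{h_{k+1}=0}^\infty(h_{k+1}+1)\Delta_{h_1}(d_1,\beta,\underline{P}_1)\cdots\Delta_{h_{k+1}}(d_{k+1},\beta,\underline{P}_{k+1})\overline{W}_{\sum_{i=1}^{k+1}h_i+k+2}(y,\beta)\quad(k\ge1),$$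 and for $Z\sim ME(\beta,\underline{P})$, $d>0$, $$U_Z(y,d)=\frac1\beta\sum_{h=0}^\infty(h+1)\Delta_h(d,\beta,\underline{P})\overline{W}_{h+2}(y,\beta),$$ where $\Delta_k(d,\beta,\underline{Q})=\beta^{-1}\sum_{j=0}^\infty q_{j+k+1}w_{j+1}(d,\beta)$.
   Formalization: It is additionally assumed that the expectation of T_l on {R_n > x_p} is finite; without this, C_l(p) is infinite, the series defining U can diverge, and the right-hand side can take the form ∞ − ∞. *)

theory Defs
  imports "HOL-Probability.Probability"
begin

text \<open>
  Mixing vectors \<open>(q\<^sub>1, q\<^sub>2, \<dots>)\<close> are functions \<open>nat \<Rightarrow> real\<close> indexed from 1; the value at 0 is
  never used. Superscripts come first: \<open>X\<^sub>j\<close> of portfolio \<open>i\<close> is \<open>X i j\<close>, and likewise for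
  \<open>\<beta>\<close>, \<open>Q\<close>; the coefficient \<open>\<alpha>\<close> with superscript \<open>(a,b)\<close> and subscript \<open>s,t\<close> is \<open>\<alpha> a b s t\<close>, where
  \<open>\<alpha> a a s t\<close> is the within-portfolio coefficient of portfolio \<open>a\<close>.
\<close>

section \<open>Mixed Erlang distributions\<close>

text \<open>The library's Erlang density with parameter \<open>m\<close> has shape \<open>m + 1\<close>.\<close>

definition w :: "nat \<Rightarrow> real \<Rightarrow> real \<Rightarrow> real" where
  "w k x \<beta> = erlang_density (k - 1) \<beta> x"

definition Wbar :: "nat \<Rightarrow> real \<Rightarrow> real \<Rightarrow> real" where
  "Wbar k x \<beta> = exp (- \<beta> * x) * (\<Sum>j<k. (\<beta> * x) ^ j / fact j)"

definition mixing_vector :: "(nat \<Rightarrow> real) \<Rightarrow> bool" where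
  "mixing_vector q \<longleftrightarrow> (\<forall>k\<ge>1. 0 \<le> q k) \<and> (\<lambda>k. q (Suc k)) sums 1"

definition ME_pdf :: "real \<Rightarrow> (nat \<Rightarrow> real) \<Rightarrow> real \<Rightarrow> real" where
  "ME_pdf \<beta> q x = (\<Sum>k. q (Suc k) * w (Suc k) x \<beta>)"

definition ME :: "real \<Rightarrow> (nat \<Rightarrow> real) \<Rightarrow> real measure" where
  "ME \<beta> q = density lborel (\<lambda>x. ennreal (ME_pdf \<beta> q x))"

section \<open>The Sarmanov model\<close>

definition \<gamma> :: "(nat \<Rightarrow> nat \<Rightarrow> real) \<Rightarrow> (nat \<Rightarrow> nat \<Rightarrow> nat \<Rightarrow> real) \<Rightarrow> nat \<Rightarrow> nat \<Rightarrow> real" where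
  "\<gamma> \<beta> Q i j = (LINT x|ME (\<beta> i j) (Q i j). ME_pdf (\<beta> i j) (Q i j) x)"

definition \<phi> :: "(nat \<Rightarrow> nat \<Rightarrow> real) \<Rightarrow> (nat \<Rightarrow> nat \<Rightarrow> nat \<Rightarrow> real) \<Rightarrow> nat \<Rightarrow> nat \<Rightarrow> real \<Rightarrow> real" where
  "\<phi> \<beta> Q i j x = ME_pdf (\<beta> i j) (Q i j) x - \<gamma> \<beta> Q i j"

definition components :: "nat \<Rightarrow> (nat \<Rightarrow> nat) \<Rightarrow> (nat \<times> nat) set" where
  "components n k = (SIGMA i:{1..n}. {1..k i})"

definition sarmanov_bracket ::
  "nat \<Rightarrow> (nat \<Rightarrow> nat) \<Rightarrow> (nat \<Rightarrow> nat \<Rightarrow> real) \<Rightarrow> (nat \<Rightarrow> nat \<Rightarrow> nat \<Rightarrow> real)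
    \<Rightarrow> (nat \<Rightarrow> nat \<Rightarrow> nat \<Rightarrow> nat \<Rightarrow> real) \<Rightarrow> (nat \<times> nat \<Rightarrow> real) \<Rightarrow> real" where
  "sarmanov_bracket n k \<beta> Q \<alpha> x =
     1 + (\<Sum>a=1..n. \<Sum>b=a+1..n. \<Sum>s=1..k a. \<Sum>t=1..k b.
            \<alpha> a b s t * \<phi> \<beta> Q a s (x (a, s)) * \<phi> \<beta> Q b t (x (b, t)))
       + (\<Sum>a=1..n. \<Sum>s=1..k a. \<Sum>t=s+1..k a.
            \<alpha> a a s t * \<phi> \<beta> Q a s (x (a, s)) * \<phi> \<beta> Q a t (x (a, t)))"

definition sarmanov_pdf ::
  "nat \<Rightarrow> (nat \<Rightarrow> nat) \<Rightarrow> (nat \<Rightarrow> nat \<Rightarrow> real) \<Rightarrow> (nat \<Rightarrow> nat \<Rightarrow> nat \<Rightarrow> real)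
    \<Rightarrow> (nat \<Rightarrow> nat \<Rightarrow> nat \<Rightarrow> nat \<Rightarrow> real) \<Rightarrow> (nat \<times> nat \<Rightarrow> real) \<Rightarrow> real" where
  "sarmanov_pdf n k \<beta> Q \<alpha> x =
     (\<Prod>i=1..n. \<Prod>j=1..k i. ME_pdf (\<beta> i j) (Q i j) (x (i, j))) * sarmanov_bracket n k \<beta> Q \<alpha> x"

text \<open>
  The bracket is required to be nonnegative on the common support \<open>[0,\<infinity>)\<close> of the
  marginals only; elsewhere the product of the marginal densities vanishes.
\<close>

definition SME ::
  "'a measure \<Rightarrow> nat \<Rightarrow> (nat \<Rightarrow> nat) \<Rightarrow> (nat \<Rightarrow> nat \<Rightarrow> real) \<Rightarrow> (nat \<Rightarrow> nat \<Rightarrow> nat \<Rightarrow> real)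
    \<Rightarrow> (nat \<Rightarrow> nat \<Rightarrow> nat \<Rightarrow> nat \<Rightarrow> real) \<Rightarrow> (nat \<Rightarrow> nat \<Rightarrow> 'a \<Rightarrow> real) \<Rightarrow> bool" where
  "SME M n k \<beta> Q \<alpha> X \<longleftrightarrow>
     prob_space M \<and> n \<ge> 1 \<and> (\<forall>i\<in>{1..n}. k i \<ge> 1) \<and>
     (\<forall>i\<in>{1..n}. \<forall>j\<in>{1..k i}. \<beta> i j > 0 \<and> mixing_vector (Q i j) \<and>
        distributed M lborel (X i j) (\<lambda>x. ennreal (ME_pdf (\<beta> i j) (Q i j) x))) \<and>
     (\<forall>x. (\<forall>c\<in>components n k. 0 \<le> x c) \<longrightarrow> 0 \<le> sarmanov_bracket n k \<beta> Q \<alpha> x) \<and>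
     distributed M (\<Pi>\<^sub>M c\<in>components n k. lborel)
       (\<lambda>\<omega>. \<lambda>c\<in>components n k. X (fst c) (snd c) \<omega>)
       (\<lambda>x. ennreal (sarmanov_pdf n k \<beta> Q \<alpha> x))"

definition Tidx :: "nat \<Rightarrow> nat \<Rightarrow> nat \<Rightarrow> nat" where
  "Tidx s a b = max 1 ((s + 1) * of_bool (a = b))"

definition \<xi> ::
  "nat \<Rightarrow> (nat \<Rightarrow> nat) \<Rightarrow> (nat \<Rightarrow> nat \<Rightarrow> real) \<Rightarrow> (nat \<Rightarrow> nat \<Rightarrow> nat \<Rightarrow> real)
    \<Rightarrow> (nat \<Rightarrow> nat \<Rightarrow> nat \<Rightarrow> nat \<Rightarrow> real) \<Rightarrow> real" where
  "\<xi> n k \<beta> Q \<alpha> =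
     1 + (\<Sum>a=1..n. \<Sum>b=a..n. \<Sum>s=1..k a. \<Sum>t=Tidx s a b..k b.
            \<alpha> a b s t * \<gamma> \<beta> Q a s * \<gamma> \<beta> Q b t)"

section \<open>Transformations of mixing vectors\<close>

text \<open>The indices of the double series in the denominator are shifted by 1.\<close>

definition V :: "(nat \<Rightarrow> real) \<Rightarrow> nat \<Rightarrow> real" where
  "V q k =
     (\<Sum>i=1..k. real ((k - 1) choose (i - 1)) * q i * q (k + 1 - i) / 2 ^ k) /
     (\<Sum>i. \<Sum>j. real ((i + j) choose i) * q (Suc i) * q (Suc j) / 2 ^ (i + j + 1))"

definition \<Psi> :: "real \<Rightarrow> real \<Rightarrow> (nat \<Rightarrow> real) \<Rightarrow> nat \<Rightarrow> real" where
  "\<Psi> \<beta>1 \<beta>2 q k =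
     (\<Sum>i=1..k. q i * real ((k - 1) choose (k - i)) * (\<beta>1 / \<beta>2) ^ i * (1 - \<beta>1 / \<beta>2) ^ (k - i))"

text \<open>\<open>mix_conv m q\<close> is \<open>\<Pi>(q 1, \<dots>, q m)\<close>, which is meaningful for \<open>m \<ge> 1\<close> only.\<close>

fun mix_conv :: "nat \<Rightarrow> (nat \<Rightarrow> nat \<Rightarrow> real) \<Rightarrow> nat \<Rightarrow> real" where
  "mix_conv 0 q l = 0"
| "mix_conv (Suc 0) q l = q 1 l"
| "mix_conv (Suc (Suc m)) q l =
     (if l \<le> Suc m then 0
      else (\<Sum>j=Suc m..l-1. mix_conv (Suc m) q j * q (Suc (Suc m)) (l - j)))"

text \<open>
  \<open>mixS A j\<close> is the mixing vector, for the scale \<open>2 * \<beta> n (k n)\<close>, of the sum over portfolio \<open>j\<close>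
  in which \<open>V\<close> has been applied to the components in \<open>A\<close>.
\<close>

definition mixS ::
  "nat \<Rightarrow> (nat \<Rightarrow> nat) \<Rightarrow> (nat \<Rightarrow> nat \<Rightarrow> real) \<Rightarrow> (nat \<Rightarrow> nat \<Rightarrow> nat \<Rightarrow> real)
    \<Rightarrow> (nat \<times> nat) set \<Rightarrow> nat \<Rightarrow> nat \<Rightarrow> real" where
  "mixS n k \<beta> Q A j =
     mix_conv (k j) (\<lambda>l.
       if (j, l) \<in> A then \<Psi> (2 * \<beta> j l) (2 * \<beta> n (k n)) (V (Q j l))
       else \<Psi> (\<beta> j l) (2 * \<beta> n (k n)) (Q j l))"

definition mixS1 ::
  "nat \<Rightarrow> (nat \<Rightarrow> nat) \<Rightarrow> (nat \<Rightarrow> nat \<Rightarrow> real) \<Rightarrow> (nat \<Rightarrow> nat \<Rightarrow> nat \<Rightarrow> real)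
    \<Rightarrow> nat \<Rightarrow> nat \<Rightarrow> real" where
  "mixS1 n k \<beta> Q j = mixS n k \<beta> Q {} j"

definition mixS3 ::
  "nat \<Rightarrow> (nat \<Rightarrow> nat) \<Rightarrow> (nat \<Rightarrow> nat \<Rightarrow> real) \<Rightarrow> (nat \<Rightarrow> nat \<Rightarrow> nat \<Rightarrow> real)
    \<Rightarrow> nat \<Rightarrow> nat \<Rightarrow> nat \<Rightarrow> nat \<Rightarrow> nat \<Rightarrow> nat \<Rightarrow> real" where
  "mixS3 n k \<beta> Q a b s t j = mixS n k \<beta> Q {(a, s), (b, t)} j"

definition mixS2 ::
  "nat \<Rightarrow> (nat \<Rightarrow> nat) \<Rightarrow> (nat \<Rightarrow> nat \<Rightarrow> real) \<Rightarrow> (nat \<Rightarrow> nat \<Rightarrow> nat \<Rightarrow> real)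
    \<Rightarrow> nat \<Rightarrow> nat \<Rightarrow> nat \<Rightarrow> nat \<Rightarrow> real" where
  "mixS2 n k \<beta> Q a s j = mixS3 n k \<beta> Q a a s s j"

section \<open>The functions U\<close>

definition \<Delta> :: "nat \<Rightarrow> real \<Rightarrow> real \<Rightarrow> (nat \<Rightarrow> real) \<Rightarrow> real" where
  "\<Delta> k d \<beta> q = (1 / \<beta>) * (\<Sum>j. q (j + k + 1) * w (j + 1) d \<beta>)"

text \<open>
  \<open>U \<beta> P J l y d\<close> is \<open>U\<close> for the pair of \<open>\<Sum>i\<in>J. Z\<^sub>i\<close> and \<open>Z\<^sub>l\<close>, where \<open>Z\<^sub>i\<close> is \<open>ME \<beta> (P i)\<close> distributed and
  \<open>l \<notin> J\<close>, at the thresholds \<open>d i\<close>. The multiple series has nonnegative terms and is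
  taken over all assignments \<open>h\<close> of naturals to \<open>insert l J\<close>. For \<open>J = {}\<close> it is the single
  series defining \<open>U\<close> of \<open>Z\<^sub>l\<close> alone.
\<close>

definition U ::
  "real \<Rightarrow> (nat \<Rightarrow> nat \<Rightarrow> real) \<Rightarrow> nat set \<Rightarrow> nat \<Rightarrow> real \<Rightarrow> (nat \<Rightarrow> real) \<Rightarrow> real" where
  "U \<beta> P J l y d =
     (1 / \<beta>) * (\<Sum>\<^sub>\<infinity>h\<in>(\<Pi>\<^sub>E i\<in>insert l J. UNIV).
       (real (h l) + 1) * (\<Prod>i\<in>insert l J. \<Delta> (h i) (d i) \<beta> (P i)) *
       Wbar ((\<Sum>i\<in>insert l J. h i) + card J + 2) y \<beta>)"

section \<open>Risk measures and stop-loss portfolios\<close>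

definition VaR :: "'a measure \<Rightarrow> real \<Rightarrow> ('a \<Rightarrow> real) \<Rightarrow> real" where
  "VaR M p Z = (LEAST x. p \<le> cdf (distr M borel Z) x)"

definition portfolio_sum :: "(nat \<Rightarrow> nat) \<Rightarrow> (nat \<Rightarrow> nat \<Rightarrow> 'a \<Rightarrow> real) \<Rightarrow> nat \<Rightarrow> 'a \<Rightarrow> real" where
  "portfolio_sum k X i \<omega> = (\<Sum>j=1..k i. X i j \<omega>)"

definition stop_loss ::
  "(nat \<Rightarrow> nat) \<Rightarrow> (nat \<Rightarrow> nat \<Rightarrow> 'a \<Rightarrow> real) \<Rightarrow> (nat \<Rightarrow> real) \<Rightarrow> nat \<Rightarrow> 'a \<Rightarrow> real" where
  "stop_loss k X d i \<omega> = max 0 (portfolio_sum k X i \<omega> - d i)"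

definition total_loss ::
  "nat \<Rightarrow> (nat \<Rightarrow> nat) \<Rightarrow> (nat \<Rightarrow> nat \<Rightarrow> 'a \<Rightarrow> real) \<Rightarrow> (nat \<Rightarrow> real) \<Rightarrow> 'a \<Rightarrow> real" where
  "total_loss n k X d \<omega> = (\<Sum>i=1..n. stop_loss k X d i \<omega>)"

definition tail_part ::
  "'a measure \<Rightarrow> real \<Rightarrow> ('a \<Rightarrow> real) \<Rightarrow> ('a \<Rightarrow> real) \<Rightarrow> 'a \<Rightarrow> real" where
  "tail_part M p T R \<omega> = T \<omega> * of_bool (R \<omega> > VaR M p R)"

definition TVaR_alloc :: "'a measure \<Rightarrow> real \<Rightarrow> ('a \<Rightarrow> real) \<Rightarrow> ('a \<Rightarrow> real) \<Rightarrow> real" where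
  "TVaR_alloc M p T R = 1 / (1 - p) * (LINT \<omega>|M. tail_part M p T R \<omega>)"

end

theory Submission
  imports Defs
begin

text \<open>
  Multiplying out the Sarmanov bracket turns the joint density into a signed combination of
  products of densities: each term \<open>\<alpha> \<phi> \<phi>'\<close>, with \<open>\<phi> = f - \<gamma>\<close>, contributes
  \<open>\<alpha> \<gamma> \<gamma>' (1 - f/\<gamma> - f'/\<gamma>' + f f'/(\<gamma> \<gamma>'))\<close>, so it only replaces one or two marginal densities \<open>f\<close>
  by the squared and normalised density \<open>f\<^sup>2/\<gamma>\<close> (lemma \<open>sarmanov_pdf_eq_squared_pdf\<close>). Such a square is
  again mixed Erlang, with mixing vector \<open>V\<close> at twice the scale (\<open>ME_square\<close>), and every mixed Erlang
  density can be rewritten at a larger scale by \<open>\<Psi>\<close> (\<open>ME_change_scale\<close>). Hence each term of the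
  combination is the law of independent mixed Erlang variables that all have the scale
  \<open>2 \<beta> n (k n)\<close>, and it suffices to compute the tail expectation under independence.

  In the independent case the portfolio sums are independent and mixed Erlang, with mixing vectors
  given by \<open>mix_conv\<close> (\<open>distr_portfolio_sums\<close>). The memoryless nature of the Erlang family makes the
  law of \<open>(S - d)\<^sub>+\<close> a mixture of the Erlang laws of shape \<open>0, 1, 2, \<dots>\<close>, where shape 0 stands for the
  point mass at 0; the weights are \<open>F\<^sub>S d\<close> for shape 0 and \<open>\<Delta> h\<close> for shape \<open>h + 1\<close>
  (\<open>nn_integral_stop_loss\<close>). Erlang laws of equal scale form a convolution semigroup in the shape,
  and multiplying the law of shape \<open>h\<close> by \<open>t\<close> gives \<open>h/\<beta>\<close> times the law of shape \<open>h + 1\<close>. So the tail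
  expectation becomes one series over all shape assignments \<open>h\<close>, with the tail of an Erlang law of
  shape \<open>\<Sum>h + 1\<close> in each term (\<open>nn_integral_tail_stop_loss\<close>). Sorting the assignments by the set of
  portfolios with positive shape, that is, the portfolios whose deductible is exceeded, produces the sum
  over \<open>J\<close> and the functions \<open>U\<close> (\<open>tail_stop_loss_eq_U\<close>).

  All identities are first proved for integrals with values in \<open>[0,\<infinity>]\<close>. The return to real numbers
  needs each term of the signed combination to be finite, which does not follow from the finiteness
  of their sum alone. It holds because \<open>T\<^sub>l\<close> is bounded on the event that the total loss does not
  exceed the value at risk: so the integrability of the tail part yields that of \<open>T\<^sub>l\<close>, thus of all
  \<open>X l j\<close>, whose marginal laws are known, and \<open>f\<^sup>2/\<gamma>\<close> is at most a constant times \<open>f\<close>.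
\<close>

section \<open>Series and Erlang densities\<close>

lemma suminf_swap_ennreal:
  fixes F :: "nat \<Rightarrow> nat \<Rightarrow> ennreal"
  shows "(\<Sum>a. \<Sum>b. F a b) = (\<Sum>b. \<Sum>a. F a b)"
  using nn_integral_suminf[of "\<lambda>b a. F a b" "count_space UNIV"]
  by (simp add: nn_integral_count_space_nat)

text \<open>
  The rearrangement of a double series along its diagonals. Working in \<^typ>\<open>ennreal\<close> frees it from
  any summability condition.
\<close>

lemma suminf_triangle_ennreal:
  fixes F :: "nat \<Rightarrow> nat \<Rightarrow> ennreal"
  shows "(\<Sum>a. \<Sum>b. F a b) = (\<Sum>n. \<Sum>a\<le>n. F a (n - a))"
proof -
  have shift: "(\<Sum>b. F a b) = (\<Sum>n. if a \<le> n then F a (n - a) else 0)" for a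
    using suminf_offset[of "\<lambda>n. if a \<le> n then F a (n - a) else 0" a] by simp
  have fin: "(\<Sum>a. if a \<le> n then F a (n - a) else 0) = (\<Sum>a\<le>n. F a (n - a))" for n
    by (subst suminf_finite[of "{..n}"]) auto
  show ?thesis
    unfolding shift by (subst suminf_swap_ennreal) (simp add: fin)
qed

lemma w_Suc: "w (Suc k) x \<beta> = erlang_density k \<beta> x"
  by (simp add: w_def)

lemma w_nonneg [simp]: "0 < \<beta> \<Longrightarrow> 0 \<le> w k x \<beta>"
  by (simp add: w_def)

lemma w_neg: "x < 0 \<Longrightarrow> w k x \<beta> = 0"
  by (simp add: w_def erlang_density_def)

lemma w_measurable [measurable]: "(\<lambda>x. w k x \<beta>) \<in> borel_measurable borel"
  by (simp add: w_def)

lemma w_le: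
  assumes "0 < \<beta>" shows "w k x \<beta> \<le> \<beta>"
proof (cases "x < 0")
  case False
  define m where "m = k - 1"
  have y: "0 \<le> \<beta> * x" using assms False by simp
  have "(\<beta> * x) ^ m /\<^sub>R fact m \<le> exp (\<beta> * x)"
    unfolding exp_def
    using sum_le_suminf[OF summable_exp_generic[of "\<beta> * x"], of "{m}"] y by simp
  then have "(\<beta> * x) ^ m * exp (- \<beta> * x) / fact m \<le> 1"
    by (simp add: exp_minus field_simps)
  then have "\<beta> * ((\<beta> * x) ^ m * exp (- \<beta> * x) / fact m) \<le> \<beta>"
    using assms by (metis mult.right_neutral mult_le_cancel_left_pos)
  with False show ?thesis
    by (simp add: w_def erlang_density_def m_def power_mult_distrib field_simps)
qed (use assms in \<open>simp add: w_neg\<close>)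

lemma nn_integral_w:
  assumes "0 < \<beta>" shows "(\<integral>\<^sup>+x. ennreal (w (Suc k) x \<beta>) \<partial>lborel) = 1"
  using nn_integral_erlang_ith_moment[OF assms, of k 0] by (simp add: w_Suc)

section \<open>Mixed Erlang densities\<close>

lemma mixing_vectorD:
  assumes "mixing_vector q"
  shows "0 \<le> q (Suc k)" "summable (\<lambda>k. q (Suc k))" "(\<Sum>k. q (Suc k)) = 1" "q (Suc k) \<le> 1"
proof -
  show *: "0 \<le> q (Suc k)" "summable (\<lambda>k. q (Suc k))" "(\<Sum>k. q (Suc k)) = 1" for k
    using assms by (auto simp: mixing_vector_def sums_iff)
  show "q (Suc k) \<le> 1"
    using sum_le_suminf[OF *(2), of "{k}"] * by simp
qed

lemma summable_ME:
  assumes "0 < \<beta>" "mixing_vector q"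
  shows "summable (\<lambda>k. q (Suc k) * w (Suc k) x \<beta>)"
  by (rule summable_comparison_test'[OF summable_mult2[OF mixing_vectorD(2)[OF assms(2)], of \<beta>], of 0])
     (use assms mixing_vectorD[OF assms(2)] in
       \<open>auto simp: abs_mult w_le intro!: mult_left_mono\<close>)

lemma ME_pdf_nonneg:
  assumes "0 < \<beta>" "mixing_vector q"
  shows "0 \<le> ME_pdf \<beta> q x"
  unfolding ME_pdf_def
  by (intro suminf_nonneg summable_ME assms mult_nonneg_nonneg w_nonneg mixing_vectorD)

lemma ME_pdf_neg: "x < 0 \<Longrightarrow> ME_pdf \<beta> q x = 0"
  by (simp add: ME_pdf_def w_neg)

lemma ME_pdf_measurable [measurable]: "ME_pdf \<beta> q \<in> borel_measurable borel"
  unfolding ME_pdf_def[abs_def] by measurable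

lemma ennreal_ME_pdf:
  assumes "0 < \<beta>" "mixing_vector q"
  shows "ennreal (ME_pdf \<beta> q x) = (\<Sum>k. ennreal (q (Suc k)) * ennreal (w (Suc k) x \<beta>))"
  unfolding ME_pdf_def
  by (subst suminf_ennreal2[symmetric])
     (use assms mixing_vectorD[OF assms(2)] in \<open>auto intro!: summable_ME simp: ennreal_mult\<close>)

lemma ME_pdf_le:
  assumes "0 < \<beta>" "mixing_vector q"
  shows "ME_pdf \<beta> q x \<le> \<beta>"
proof -
  have "ME_pdf \<beta> q x \<le> (\<Sum>k. q (Suc k) * \<beta>)"
    unfolding ME_pdf_def
    by (rule suminf_le)
       (use assms mixing_vectorD[OF assms(2)] in
         \<open>auto intro!: summable_ME summable_mult2 mult_left_mono w_le\<close>)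
  also have "\<dots> = \<beta>"
    using suminf_mult2[OF mixing_vectorD(2)[OF assms(2)], of \<beta>] mixing_vectorD(3)[OF assms(2)] by simp
  finally show ?thesis .
qed

lemma suminf_mixing_vector:
  assumes "mixing_vector q"
  shows "(\<Sum>k. ennreal (q (Suc k))) = 1"
  using mixing_vectorD[OF assms] by (subst suminf_ennreal2) auto

lemma nn_integral_ME:
  assumes "0 < \<beta>" "mixing_vector q" and [measurable]: "G \<in> borel_measurable borel"
  shows "(\<integral>\<^sup>+x. G x \<partial>ME \<beta> q)
    = (\<Sum>k. ennreal (q (Suc k)) * (\<integral>\<^sup>+x. ennreal (w (Suc k) x \<beta>) * G x \<partial>lborel))"
proof -
  have "(\<integral>\<^sup>+x. G x \<partial>ME \<beta> q) = (\<integral>\<^sup>+x. ennreal (ME_pdf \<beta> q x) * G x \<partial>lborel)"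
    unfolding ME_def by (subst nn_integral_density) auto
  also have "\<dots> = (\<integral>\<^sup>+x. (\<Sum>k. ennreal (q (Suc k)) * (ennreal (w (Suc k) x \<beta>) * G x)) \<partial>lborel)"
    by (simp add: ennreal_ME_pdf assms ennreal_suminf_multc[symmetric] mult.assoc)
  also have "\<dots> = (\<Sum>k. \<integral>\<^sup>+x. ennreal (q (Suc k)) * (ennreal (w (Suc k) x \<beta>) * G x) \<partial>lborel)"
    by (rule nn_integral_suminf) measurable
  also have "\<dots> = (\<Sum>k. ennreal (q (Suc k)) * (\<integral>\<^sup>+x. ennreal (w (Suc k) x \<beta>) * G x \<partial>lborel))"
    by (simp add: nn_integral_cmult)
  finally show ?thesis .
qed

lemma sets_ME [simp, measurable_cong]: "sets (ME \<beta> q) = sets borel"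
  by (simp add: ME_def)

lemma space_ME [simp]: "space (ME \<beta> q) = UNIV"
  by (simp add: ME_def)

lemma prob_space_ME:
  assumes "0 < \<beta>" "mixing_vector q"
  shows "prob_space (ME \<beta> q)"
proof
  have "emeasure (ME \<beta> q) (space (ME \<beta> q)) = (\<integral>\<^sup>+x. 1 \<partial>ME \<beta> q)" by simp
  also have "\<dots> = 1"
    using assms by (subst nn_integral_ME) (auto simp: nn_integral_w suminf_mixing_vector)
  finally show "emeasure (ME \<beta> q) (space (ME \<beta> q)) = 1" .
qed

lemma nn_integral_ME_pdf:
  assumes "0 < \<beta>" "mixing_vector q"
  shows "(\<integral>\<^sup>+x. ennreal (ME_pdf \<beta> q x) \<partial>lborel) = 1"
  using prob_space.emeasure_space_1[OF prob_space_ME[OF assms]]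
  by (simp add: ME_def emeasure_density)

lemma mixing_vectorI_suminf:
  assumes q: "\<And>k. 0 \<le> q (Suc k)" and sum: "(\<Sum>k. ennreal (q (Suc k))) = 1"
  shows "mixing_vector q"
proof -
  have "summable (\<lambda>k. q (Suc k))"
    using q sum by (intro summable_suminf_not_top) auto
  then have "(\<lambda>k. q (Suc k)) sums 1"
    using q sum by (simp add: suminf_ennreal2 sums_iff)
  moreover have "0 \<le> q k" if "1 \<le> k" for k
    using q[of "k - 1"] that by simp
  ultimately show ?thesis by (simp add: mixing_vector_def)
qed

text \<open>
  A density that is a nonnegative combination of Erlang densities has weights of total mass 1, as
  integrating the combination term by term shows. So for the change of scale and for the squares
  only the pointwise identity of densities needs a computation.
\<close>

lemma mixing_vectorI:
  assumes B: "0 < \<beta>" and q: "\<And>k. 0 \<le> q (Suc k)"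
    and f: "\<And>x. f x = (\<Sum>k. ennreal (q (Suc k)) * ennreal (w (Suc k) x \<beta>))"
    and int: "(\<integral>\<^sup>+x. f x \<partial>lborel) = 1"
  shows "mixing_vector q" "\<And>x. f x = ennreal (ME_pdf \<beta> q x)"
proof -
  have "(\<Sum>k. ennreal (q (Suc k))) = 1"
    unfolding int[symmetric] f
    by (subst nn_integral_suminf) (auto simp: nn_integral_cmult nn_integral_w B)
  with q show "mixing_vector q" by (rule mixing_vectorI_suminf)
  from ennreal_ME_pdf[OF B this] show "\<And>x. f x = ennreal (ME_pdf \<beta> q x)" by (simp add: f)
qed

section \<open>Change of scale\<close>

text \<open>
  With \<open>r = \<beta>\<^sub>1 / \<beta>\<^sub>2\<close>, write \<open>exp (- \<beta>\<^sub>1 x)\<close> as \<open>exp (- \<beta>\<^sub>2 x)\<close> times the exponential series of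
  \<open>(1 - r) \<beta>\<^sub>2 x\<close>; its \<open>m\<close>-th term raises the shape of the Erlang density by \<open>m\<close>.
\<close>

lemma w_change_scale:
  assumes "0 < \<beta>\<^sub>1" "\<beta>\<^sub>1 \<le> \<beta>\<^sub>2"
  shows "ennreal (w (Suc i) x \<beta>\<^sub>1) =
    (\<Sum>m. ennreal (real ((i + m) choose m) * (\<beta>\<^sub>1 / \<beta>\<^sub>2) ^ Suc i * (1 - \<beta>\<^sub>1 / \<beta>\<^sub>2) ^ m)
      * ennreal (w (Suc (i + m)) x \<beta>\<^sub>2))"
proof (cases "x < 0")
  case False
  define r where "r = \<beta>\<^sub>1 / \<beta>\<^sub>2"
  have r: "0 < r" "r \<le> 1" and \<beta>\<^sub>2: "0 < \<beta>\<^sub>2" and \<beta>\<^sub>1: "\<beta>\<^sub>1 = r * \<beta>\<^sub>2"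
    using assms by (auto simp: r_def)
  define c where "c = r ^ Suc i * \<beta>\<^sub>2 ^ Suc i * x ^ i * exp (- \<beta>\<^sub>2 * x) / fact i"
  have "(\<lambda>m. c * (((1 - r) * \<beta>\<^sub>2 * x) ^ m /\<^sub>R fact m)) sums (c * exp ((1 - r) * \<beta>\<^sub>2 * x))"
    by (intro sums_mult exp_converges)
  moreover have "c * ((s * \<beta>\<^sub>2 * x) ^ m /\<^sub>R fact m)
      = real ((i + m) choose m) * r ^ Suc i * s ^ m * w (Suc (i + m)) x \<beta>\<^sub>2" for m s
    using False binomial_fact[of m "i + m", where 'a=real]
    by (simp add: c_def w_def erlang_density_def power_mult_distrib power_add field_simps)
  moreover have "c * exp ((1 - r) * \<beta>\<^sub>2 * x) = w (Suc i) x \<beta>\<^sub>1"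
    using False
    by (simp add: c_def w_def erlang_density_def \<beta>\<^sub>1 power_mult_distrib mult_exp_exp algebra_simps)
  ultimately have sums: "(\<lambda>m. real ((i + m) choose m) * r ^ Suc i * (1 - r) ^ m * w (Suc (i + m)) x \<beta>\<^sub>2)
      sums w (Suc i) x \<beta>\<^sub>1"
    by simp
  have "(\<Sum>m. ennreal (real ((i + m) choose m) * r ^ Suc i * (1 - r) ^ m)
      * ennreal (w (Suc (i + m)) x \<beta>\<^sub>2))
    = (\<Sum>m. ennreal (real ((i + m) choose m) * r ^ Suc i * (1 - r) ^ m * w (Suc (i + m)) x \<beta>\<^sub>2))"
    using r \<beta>\<^sub>2 by (subst ennreal_mult[symmetric]) auto
  also have "\<dots> = ennreal (w (Suc i) x \<beta>\<^sub>1)"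
    using r \<beta>\<^sub>2 sums by (subst suminf_ennreal2) (auto simp: sums_iff)
  finally show ?thesis by (simp add: r_def)
qed (simp add: w_neg)

lemma \<Psi>_Suc:
  "\<Psi> \<beta>\<^sub>1 \<beta>\<^sub>2 q (Suc k) =
    (\<Sum>i\<le>k. q (Suc i) * (real (k choose (k - i)) * (\<beta>\<^sub>1 / \<beta>\<^sub>2) ^ Suc i * (1 - \<beta>\<^sub>1 / \<beta>\<^sub>2) ^ (k - i)))"
  unfolding \<Psi>_def
  unfolding One_nat_def sum.shift_bounds_cl_Suc_ivl
  by (simp add: atLeast0AtMost mult.assoc)

lemma ME_change_scale:
  assumes "0 < \<beta>\<^sub>1" "\<beta>\<^sub>1 \<le> \<beta>\<^sub>2" "mixing_vector q"
  shows "mixing_vector (\<Psi> \<beta>\<^sub>1 \<beta>\<^sub>2 q)" "ME_pdf \<beta>\<^sub>2 (\<Psi> \<beta>\<^sub>1 \<beta>\<^sub>2 q) x = ME_pdf \<beta>\<^sub>1 q x"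
proof -
  define r where "r = \<beta>\<^sub>1 / \<beta>\<^sub>2"
  have r: "0 < r" "r \<le> 1" and \<beta>\<^sub>2: "0 < \<beta>\<^sub>2"
    using assms by (auto simp: r_def)
  note q = mixing_vectorD[OF assms(3)]
  have nonneg: "0 \<le> \<Psi> \<beta>\<^sub>1 \<beta>\<^sub>2 q (Suc k)" for k
    unfolding \<Psi>_Suc r_def[symmetric] using r q by (auto intro!: sum_nonneg)
  have "ennreal (ME_pdf \<beta>\<^sub>1 q x) = (\<Sum>i. \<Sum>m. ennreal (q (Suc i)) *
      (ennreal (real ((i + m) choose m) * r ^ Suc i * (1 - r) ^ m) * ennreal (w (Suc (i + m)) x \<beta>\<^sub>2)))" for x
    unfolding ennreal_ME_pdf[OF assms(1,3)] w_change_scale[OF assms(1,2)] r_def by simp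
  also have "\<dots> x = (\<Sum>k. ennreal (\<Psi> \<beta>\<^sub>1 \<beta>\<^sub>2 q (Suc k)) * ennreal (w (Suc k) x \<beta>\<^sub>2))" for x
    unfolding suminf_triangle_ennreal \<Psi>_Suc r_def[symmetric]
    using r q by (subst sum_ennreal[symmetric]) (auto simp: sum_distrib_right ennreal_mult mult.assoc)
  finally have f: "ennreal (ME_pdf \<beta>\<^sub>1 q x) =
      (\<Sum>k. ennreal (\<Psi> \<beta>\<^sub>1 \<beta>\<^sub>2 q (Suc k)) * ennreal (w (Suc k) x \<beta>\<^sub>2))" for x .
  note * = mixing_vectorI[OF \<beta>\<^sub>2 nonneg f nn_integral_ME_pdf[OF assms(1,3)]]
  show "mixing_vector (\<Psi> \<beta>\<^sub>1 \<beta>\<^sub>2 q)" by (rule *)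
  then show "ME_pdf \<beta>\<^sub>2 (\<Psi> \<beta>\<^sub>1 \<beta>\<^sub>2 q) x = ME_pdf \<beta>\<^sub>1 q x"
    using *(2)[of x] ME_pdf_nonneg[OF \<beta>\<^sub>2] ME_pdf_nonneg[OF assms(1,3)] by simp
qed

section \<open>Squares of mixed Erlang densities\<close>

lemma w_mult:
  assumes "0 < \<beta>"
  shows "w (Suc i) x \<beta> * w (Suc j) x \<beta> =
    \<beta> * (real ((i + j) choose i) / 2 ^ (i + j + 1)) * w (Suc (i + j)) x (2 * \<beta>)"
  using assms binomial_fact[of i "i + j", where 'a=real]
  by (simp add: w_def erlang_density_def power_mult_distrib power_add mult_exp_exp field_simps)

text \<open>
  Numerator and denominator of \<^const>\<open>V\<close>. The numerators \<open>V_num q n\<close> are the diagonal sums of the double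
  series \<open>V_den q\<close>; the shift in the index makes \<open>V_num q n\<close> belong to shape \<open>n + 1\<close>.
\<close>

definition V_num :: "(nat \<Rightarrow> real) \<Rightarrow> nat \<Rightarrow> real" where
  "V_num q n = (\<Sum>i\<le>n. real (n choose i) * q (Suc i) * q (Suc (n - i)) / 2 ^ Suc n)"

definition V_den :: "(nat \<Rightarrow> real) \<Rightarrow> real" where
  "V_den q = (\<Sum>i. \<Sum>j. real ((i + j) choose i) * q (Suc i) * q (Suc j) / 2 ^ (i + j + 1))"

lemma V_Suc: "V q (Suc n) = V_num q n / V_den q"
  unfolding V_def V_num_def V_den_def
  unfolding One_nat_def sum.shift_bounds_cl_Suc_ivl
  by (simp add: atLeast0AtMost Suc_diff_le)

lemma V_num_nonneg: "mixing_vector q \<Longrightarrow> 0 \<le> V_num q n"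
  unfolding V_num_def by (auto intro!: sum_nonneg simp: mixing_vectorD)

lemma choose_le_2_power: "real ((i + j) choose i) / 2 ^ (i + j + 1) \<le> 1"
proof -
  have "(i + j) choose i \<le> 2 ^ (i + j)"
    using binomial_le_pow2 by blast
  also have "\<dots> \<le> 2 ^ (i + j + 1)" by simp
  finally have "real ((i + j) choose i) \<le> real (2 ^ (i + j + 1))" by (rule of_nat_mono)
  then show ?thesis by simp
qed

lemma V_den:
  assumes q: "mixing_vector q"
  shows "ennreal (V_den q) = (\<Sum>n. ennreal (V_num q n))" "0 < V_den q"
proof -
  define t where "t i j = real ((i + j) choose i) * q (Suc i) * q (Suc j) / 2 ^ (i + j + 1)" for i j
  note q' = mixing_vectorD[OF q]
  have t0: "0 \<le> t i j" for i j using q' by (simp add: t_def)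
  have t1: "t i j \<le> q (Suc i) * q (Suc j)" for i j
    using mult_right_mono[OF choose_le_2_power, of "q (Suc i) * q (Suc j)" i j] q'
    by (simp add: t_def field_simps)
  have s1: "summable (t i)" for i
    by (rule summable_comparison_test'[OF summable_mult[OF q'(2), of "q (Suc i)"], of 0])
       (use t0 t1 in auto)
  have "suminf (t i) \<le> (\<Sum>j. q (Suc i) * q (Suc j))" for i
    by (intro suminf_le s1 t1 summable_mult q')
  then have le: "suminf (t i) \<le> q (Suc i)" for i
    using suminf_mult[OF q'(2)] q'(3) by simp
  have s2: "summable (\<lambda>i. suminf (t i))"
    by (rule summable_comparison_test'[OF q'(2), of 0])
       (use le suminf_nonneg[OF s1 t0] in auto)
  have "ennreal (V_den q) = (\<Sum>i. \<Sum>j. ennreal (t i j))"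
    unfolding V_den_def t_def[symmetric]
    by (simp add: suminf_ennreal2 s1 s2 t0 suminf_nonneg)
  also have "\<dots> = (\<Sum>n. ennreal (V_num q n))"
    unfolding suminf_triangle_ennreal V_num_def
    by (subst sum_ennreal) (auto simp: q' t_def)
  finally show "ennreal (V_den q) = (\<Sum>n. ennreal (V_num q n))" .
  obtain i where i: "0 < q (Suc i)"
  proof (rule ccontr)
    assume "\<not> thesis"
    then have "q (Suc i) = 0" for i using that q'(1)[of i] by (metis less_eq_real_def)
    then show False using q'(3) by simp
  qed
  have "0 < t i i" using i by (simp add: t_def)
  then have "0 < suminf (t i)" using suminf_pos2[OF s1 t0] by blast
  then have "0 < (\<Sum>i. suminf (t i))" using suminf_pos2[OF s2 suminf_nonneg[OF s1 t0]] by blast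
  then show "0 < V_den q" by (simp add: V_den_def t_def[abs_def])
qed

text \<open>
  The product of two Erlang densities of shapes \<open>i + 1\<close> and \<open>j + 1\<close> is a multiple of the one of
  shape \<open>i + j + 1\<close> at twice the scale, so the square of the series collects along its diagonals.
\<close>

lemma ennreal_ME_pdf_square:
  assumes \<beta>: "0 < \<beta>" and q: "mixing_vector q"
  shows "ennreal (ME_pdf \<beta> q x ^ 2) =
    (\<Sum>n. ennreal (\<beta> * V_num q n) * ennreal (w (Suc n) x (2 * \<beta>)))"
proof -
  note q' = mixing_vectorD[OF q]
  have "ennreal (ME_pdf \<beta> q x ^ 2) = (\<Sum>i. \<Sum>j.
      (ennreal (q (Suc i)) * ennreal (w (Suc i) x \<beta>)) * (ennreal (q (Suc j)) * ennreal (w (Suc j) x \<beta>)))"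
    unfolding power2_eq_square
    by (simp add: ennreal_mult ME_pdf_nonneg[OF assms] ennreal_ME_pdf[OF assms])
  also have "\<dots> = (\<Sum>i. \<Sum>j. ennreal (\<beta> * (real ((i + j) choose i) * q (Suc i) * q (Suc j) / 2 ^ (i + j + 1))
      * w (Suc (i + j)) x (2 * \<beta>)))"
  proof (intro suminf_cong)
    fix i j
    have "(q (Suc i) * w (Suc i) x \<beta>) * (q (Suc j) * w (Suc j) x \<beta>)
      = q (Suc i) * q (Suc j) * (w (Suc i) x \<beta> * w (Suc j) x \<beta>)" by (simp add: mult_ac)
    also have "\<dots> = \<beta> * (real ((i + j) choose i) * q (Suc i) * q (Suc j) / 2 ^ (i + j + 1))
        * w (Suc (i + j)) x (2 * \<beta>)"
      unfolding w_mult[OF \<beta>] by simp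
    finally show "(ennreal (q (Suc i)) * ennreal (w (Suc i) x \<beta>)) * (ennreal (q (Suc j)) * ennreal (w (Suc j) x \<beta>))
      = ennreal (\<beta> * (real ((i + j) choose i) * q (Suc i) * q (Suc j) / 2 ^ (i + j + 1))
        * w (Suc (i + j)) x (2 * \<beta>))"
      using \<beta> q' by (simp flip: ennreal_mult)
  qed
  also have "\<dots> = (\<Sum>n. ennreal (\<beta> * V_num q n) * ennreal (w (Suc n) x (2 * \<beta>)))"
    unfolding suminf_triangle_ennreal
  proof (rule suminf_cong)
    fix n
    have "(\<Sum>i\<le>n. ennreal (\<beta> * (real ((i + (n - i)) choose i) * q (Suc i) * q (Suc (n - i)) / 2 ^ (i + (n - i) + 1))
        * w (Suc (i + (n - i))) x (2 * \<beta>)))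
      = ennreal (\<Sum>i\<le>n. \<beta> * (real (n choose i) * q (Suc i) * q (Suc (n - i)) / 2 ^ Suc n)
        * w (Suc n) x (2 * \<beta>))"
      using \<beta> q' by (subst sum_ennreal[symmetric]) auto
    also have "\<dots> = ennreal (\<beta> * V_num q n * w (Suc n) x (2 * \<beta>))"
      by (simp add: V_num_def sum_distrib_left sum_distrib_right)
    also have "\<dots> = ennreal (\<beta> * V_num q n) * ennreal (w (Suc n) x (2 * \<beta>))"
      using \<beta> V_num_nonneg[OF q] by (simp add: ennreal_mult)
    finally show "(\<Sum>i\<le>n. ennreal (\<beta> * (real ((i + (n - i)) choose i) * q (Suc i) * q (Suc (n - i)) / 2 ^ (i + (n - i) + 1))
        * w (Suc (i + (n - i))) x (2 * \<beta>))) = ennreal (\<beta> * V_num q n) * ennreal (w (Suc n) x (2 * \<beta>))" .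
  qed
  finally show ?thesis .
qed

text \<open>
  Integrating the expansion of the square gives \<open>\<gamma> = \<beta> V_den q\<close>, which is exactly the factor that
  normalises the numerators.
\<close>

lemma ME_square:
  assumes \<beta>: "0 < \<beta>" and q: "mixing_vector q"
  defines "g \<equiv> (LINT x|ME \<beta> q. ME_pdf \<beta> q x)"
  shows "0 < g" "mixing_vector (V q)" "ME_pdf (2 * \<beta>) (V q) x = ME_pdf \<beta> q x ^ 2 / g"
proof -
  note [simp] = ME_pdf_nonneg[OF \<beta> q]
  have "(\<integral>\<^sup>+x. ennreal (ME_pdf \<beta> q x ^ 2) \<partial>lborel) = (\<Sum>n. ennreal (\<beta> * V_num q n))"
    unfolding ennreal_ME_pdf_square[OF \<beta> q]
    by (subst nn_integral_suminf) (auto simp: nn_integral_cmult nn_integral_w \<beta>)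
  also have "\<dots> = ennreal (\<beta> * V_den q)"
    using \<beta> V_num_nonneg[OF q] V_den[OF q] by (simp add: ennreal_mult)
  finally have int: "(\<integral>\<^sup>+x. ennreal (ME_pdf \<beta> q x ^ 2) \<partial>lborel) = ennreal (\<beta> * V_den q)" .
  have "g = (LINT x|lborel. ME_pdf \<beta> q x ^ 2)"
    unfolding g_def ME_def by (subst integral_density) (auto simp: power2_eq_square)
  also have "\<dots> = \<beta> * V_den q"
    using \<beta> V_den(2)[OF q] int by (subst integral_eq_nn_integral) auto
  finally have g: "g = \<beta> * V_den q" .
  then show g0: "0 < g" using \<beta> V_den(2)[OF q] by simp
  have nonneg: "0 \<le> V q (Suc k)" for k
    unfolding V_Suc using V_num_nonneg[OF q] V_den(2)[OF q] by simp
  have f: "ennreal (ME_pdf \<beta> q x ^ 2 / g) = (\<Sum>k. ennreal (V q (Suc k)) * ennreal (w (Suc k) x (2 * \<beta>)))" for x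
  proof -
    have "ennreal (ME_pdf \<beta> q x ^ 2 / g) = ennreal (1 / g) * ennreal (ME_pdf \<beta> q x ^ 2)"
      using g0 by (simp flip: ennreal_mult)
    also have "\<dots> = (\<Sum>k. ennreal (1 / g) * (ennreal (\<beta> * V_num q k) * ennreal (w (Suc k) x (2 * \<beta>))))"
      unfolding ennreal_ME_pdf_square[OF \<beta> q] by simp
    also have "\<dots> = (\<Sum>k. ennreal (V q (Suc k)) * ennreal (w (Suc k) x (2 * \<beta>)))"
    proof (rule suminf_cong)
      fix k
      have "1 / g * (\<beta> * V_num q k) = V q (Suc k)"
        using \<beta> by (simp add: V_Suc g)
      then show "ennreal (1 / g) * (ennreal (\<beta> * V_num q k) * ennreal (w (Suc k) x (2 * \<beta>)))
          = ennreal (V q (Suc k)) * ennreal (w (Suc k) x (2 * \<beta>))"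
        using g0 \<beta> V_num_nonneg[OF q, of k] nonneg[of k]
        by (simp add: mult.assoc[symmetric] flip: ennreal_mult)
    qed
    finally show ?thesis .
  qed
  have "(\<integral>\<^sup>+x. ennreal (ME_pdf \<beta> q x ^ 2 / g) \<partial>lborel) = (\<integral>\<^sup>+x. ennreal (1 / g) * ennreal (ME_pdf \<beta> q x ^ 2) \<partial>lborel)"
    using g0 by (simp flip: ennreal_mult)
  also have "\<dots> = 1"
    using g0 by (subst nn_integral_cmult) (auto simp: int g[symmetric] simp flip: ennreal_mult)
  finally have "(\<integral>\<^sup>+x. ennreal (ME_pdf \<beta> q x ^ 2 / g) \<partial>lborel) = 1" .
  note * = mixing_vectorI[OF _ nonneg f this, simplified, OF \<beta>]
  show "mixing_vector (V q)" by (rule *)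
  then have "0 \<le> ME_pdf (2 * \<beta>) (V q) x" using \<beta> by (simp add: ME_pdf_nonneg)
  then show "ME_pdf (2 * \<beta>) (V q) x = ME_pdf \<beta> q x ^ 2 / g"
    using *(2)[of x] g0 by simp
qed

section \<open>Sums of independent mixed Erlang variables\<close>

definition conv_vector :: "(nat \<Rightarrow> real) \<Rightarrow> (nat \<Rightarrow> real) \<Rightarrow> nat \<Rightarrow> real" where
  "conv_vector p q l = (\<Sum>j=1..l-1. p j * q (l - j))"

lemma conv_vector_Suc_0: "conv_vector p q (Suc 0) = 0"
  by (simp add: conv_vector_def)

lemma conv_vector_Suc_Suc: "conv_vector p q (Suc (Suc n)) = (\<Sum>i\<le>n. p (Suc i) * q (Suc (n - i)))"
  unfolding conv_vector_def One_nat_def diff_Suc_Suc diff_zero sum.shift_bounds_cl_Suc_ivl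
  by (simp add: atLeast0AtMost Suc_diff_le)

lemma suminf_conv_vector:
  fixes F :: "nat \<Rightarrow> ennreal"
  assumes p: "mixing_vector p" and q: "mixing_vector q"
  shows "(\<Sum>l. ennreal (conv_vector p q (Suc l)) * F (Suc l))
    = (\<Sum>i. \<Sum>j. ennreal (p (Suc i)) * (ennreal (q (Suc j)) * F (Suc i + Suc j)))"
proof -
  have "(\<Sum>l. ennreal (conv_vector p q (Suc l)) * F (Suc l))
      = (\<Sum>n. ennreal (conv_vector p q (Suc (Suc n))) * F (Suc (Suc n)))"
    using suminf_offset[of "\<lambda>l. ennreal (conv_vector p q (Suc l)) * F (Suc l)" 1]
    by (simp add: conv_vector_Suc_0)
  also have "\<dots> = (\<Sum>n. \<Sum>i\<le>n. ennreal (p (Suc i)) * (ennreal (q (Suc (n - i))) * F (Suc i + Suc (n - i))))"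
    unfolding conv_vector_Suc_Suc
    by (subst sum_ennreal[symmetric])
       (auto simp: mixing_vectorD[OF p] mixing_vectorD[OF q] sum_distrib_right ennreal_mult mult.assoc)
  finally show ?thesis unfolding suminf_triangle_ennreal .
qed

lemma mixing_conv_vector:
  assumes p: "mixing_vector p" and q: "mixing_vector q"
  shows "mixing_vector (conv_vector p q)"
proof -
  have nonneg: "0 \<le> conv_vector p q l" for l
    unfolding conv_vector_def
    by (intro sum_nonneg mult_nonneg_nonneg) (use p q in \<open>auto simp: mixing_vector_def\<close>)
  have "(\<Sum>l. ennreal (conv_vector p q (Suc l))) = 1"
    using suminf_conv_vector[OF p q, of "\<lambda>_. 1"]
    by (simp add: suminf_mixing_vector[OF p] suminf_mixing_vector[OF q])
  then show ?thesis
    by (intro mixing_vectorI_suminf nonneg)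
qed

lemma conv_vector_commute: "conv_vector p q = conv_vector q p"
proof
  show "conv_vector p q l = conv_vector q p l" for l
    unfolding conv_vector_def
    by (rule sum.reindex_bij_witness[of _ "\<lambda>j. l - j" "\<lambda>j. l - j"]) auto
qed

lemma w_convolution:
  assumes "0 < \<beta>"
  shows "(\<integral>\<^sup>+y. ennreal (w (Suc i) (x - y) \<beta>) * ennreal (w (Suc j) y \<beta>) \<partial>lborel)
    = ennreal (w (Suc i + Suc j) x \<beta>)"
  using fun_cong[OF convolution_erlang_density[OF assms, of i j], of x] by (simp add: w_def)

lemma ME_convolution:
  assumes \<beta>: "0 < \<beta>" and p: "mixing_vector p" and q: "mixing_vector q"
  shows "(\<integral>\<^sup>+y. ennreal (ME_pdf \<beta> p (x - y)) * ennreal (ME_pdf \<beta> q y) \<partial>lborel)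
    = ennreal (ME_pdf \<beta> (conv_vector p q) x)"
proof -
  have "(\<integral>\<^sup>+y. ennreal (ME_pdf \<beta> p (x - y)) * ennreal (ME_pdf \<beta> q y) \<partial>lborel)
    = (\<integral>\<^sup>+y. (\<Sum>i. \<Sum>j. ennreal (p (Suc i)) * (ennreal (q (Suc j)) *
        (ennreal (w (Suc i) (x - y) \<beta>) * ennreal (w (Suc j) y \<beta>)))) \<partial>lborel)"
    unfolding ennreal_ME_pdf[OF \<beta> p] ennreal_ME_pdf[OF \<beta> q] ennreal_suminf_multc[symmetric]
    unfolding ennreal_suminf_cmult[symmetric]
    by (simp only: mult_ac)
  also have "\<dots> = (\<Sum>i. \<Sum>j. ennreal (p (Suc i)) * (ennreal (q (Suc j)) *
        (\<integral>\<^sup>+y. ennreal (w (Suc i) (x - y) \<beta>) * ennreal (w (Suc j) y \<beta>) \<partial>lborel)))"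
    by (simp add: nn_integral_suminf nn_integral_cmult)
  also have "\<dots> = ennreal (ME_pdf \<beta> (conv_vector p q) x)"
    unfolding w_convolution[OF \<beta>] ennreal_ME_pdf[OF \<beta> mixing_conv_vector[OF p q]]
    by (rule suminf_conv_vector[OF p q, symmetric])
  finally show ?thesis .
qed

lemma mix_conv_eq_0: "1 \<le> l \<Longrightarrow> l < m \<Longrightarrow> mix_conv m q l = 0"
  by (induction m q l rule: mix_conv.induct) auto

text \<open>
  The recursion for \<^const>\<open>mix_conv\<close> sums only from \<open>j = m + 1\<close> because its first \<open>m\<close> entries vanish, a sum
  of \<open>m + 1\<close> variables having shape at least \<open>m + 1\<close>; so it is an ordinary convolution.
\<close>

lemma mix_conv_Suc:
  "mix_conv (Suc (Suc m)) q l = conv_vector (mix_conv (Suc m) q) (q (Suc (Suc m))) l"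
proof -
  have "(\<Sum>j=Suc m..l-1. mix_conv (Suc m) q j * q (Suc (Suc m)) (l - j))
      = (\<Sum>j=1..l-1. mix_conv (Suc m) q j * q (Suc (Suc m)) (l - j))"
    by (rule sum.mono_neutral_left) (auto simp: mix_conv_eq_0 Suc_le_eq)
  moreover have "(\<Sum>j=Suc m..l-1. mix_conv (Suc m) q j * q (Suc (Suc m)) (l - j)) = 0" if "l \<le> Suc m"
    using that by (intro sum.neutral) auto
  ultimately show ?thesis
    unfolding conv_vector_def by (cases "l \<le> Suc m") simp_all
qed

lemma mixing_mix_conv:
  assumes "1 \<le> m" "\<And>j. j \<in> {1..m} \<Longrightarrow> mixing_vector (q j)"
  shows "mixing_vector (mix_conv m q)"
  using assms
proof (induction m rule: dec_induct)
  case base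
  then show ?case by (simp add: mixing_vector_def)
next
  case (step m)
  then obtain m' where m: "m = Suc m'" by (cases m) auto
  show ?case
    using step unfolding m mix_conv_Suc[abs_def] by (intro mixing_conv_vector) auto
qed

lemma mix_conv_cong:
  assumes "\<And>j. j \<in> {1..m} \<Longrightarrow> p j = q j"
  shows "mix_conv m p l = mix_conv m q l"
  using assms
proof (induction m p l rule: mix_conv.induct)
  case (3 m p l)
  then show ?case by (auto intro!: sum.cong)
qed auto

lemma (in prob_space) indep_vars_reindex:
  assumes "inj_on f L" and ind: "indep_vars (\<lambda>_. N) X (f ` L)"
  shows "indep_vars (\<lambda>_. N) (\<lambda>j. X (f j)) L"
proof -
  have "indep_vars (\<lambda>j. PiM {f j} (\<lambda>_. N)) (\<lambda>j \<omega>. \<lambda>i\<in>{f j}. X i \<omega>) L"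
    using assms by (intro indep_vars_restrict[OF ind]) (auto simp: disjoint_family_on_def inj_on_def)
  then have "indep_vars (\<lambda>_. N) (\<lambda>j. (\<lambda>g. g (f j)) \<circ> (\<lambda>\<omega>. \<lambda>i\<in>{f j}. X i \<omega>)) L"
    by (rule indep_vars_compose) auto
  then show ?thesis by (simp add: comp_def)
qed

lemma (in prob_space) distr_sum_ME:
  fixes X :: "nat \<Rightarrow> 'a \<Rightarrow> real"
  assumes \<beta>: "0 < \<beta>" and m: "1 \<le> m" and indep: "indep_vars (\<lambda>_. borel) X {1..m}"
    and q: "\<And>j. j \<in> {1..m} \<Longrightarrow> mixing_vector (q j)"
    and X: "\<And>j. j \<in> {1..m} \<Longrightarrow> distr M borel (X j) = ME \<beta> (q j)"
  shows "distr M borel (\<lambda>\<omega>. \<Sum>j=1..m. X j \<omega>) = ME \<beta> (mix_conv m q)"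
  using m indep q X
proof (induction m rule: dec_induct)
  case base
  then show ?case by (simp add: ME_def ME_pdf_def)
next
  case (step m)
  then obtain m' where m: "m = Suc m'" by (cases m) auto
  have rv: "random_variable borel (X j)" if "j \<in> {1..Suc m}" for j
    using step.prems(1) that by (auto simp: indep_vars_def)
  have mix: "mixing_vector (mix_conv m q)" "mixing_vector (q (Suc m))"
    using step by (auto intro: mixing_mix_conv)
  have ind: "indep_var borel (X (Suc m)) borel (\<lambda>\<omega>. \<Sum>j\<in>{1..m}. X j \<omega>)"
    by (rule indep_vars_sum) (use step.prems(1) in \<open>auto simp: atLeastAtMostSuc_conv\<close>)

  have IH: "distr M borel (\<lambda>\<omega>. \<Sum>j=1..m. X j \<omega>) = ME \<beta> (mix_conv m q)"
    by (rule step.IH) (use step.prems in \<open>auto intro: indep_vars_subset\<close>)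
  have sum: "distributed M lborel (\<lambda>\<omega>. \<Sum>j=1..m. X j \<omega>) (\<lambda>x. ennreal (ME_pdf \<beta> (mix_conv m q) x))"
    unfolding distributed_def using IH rv
    by (auto simp: ME_def cong: distr_cong)
  have last: "distributed M lborel (X (Suc m)) (\<lambda>x. ennreal (ME_pdf \<beta> (q (Suc m)) x))"
    unfolding distributed_def using step.prems(3)[of "Suc m"] rv[of "Suc m"]
    by (auto simp: ME_def cong: distr_cong)
  have "distributed M lborel (\<lambda>\<omega>. X (Suc m) \<omega> + (\<Sum>j=1..m. X j \<omega>))
      (\<lambda>x. ennreal (ME_pdf \<beta> (conv_vector (q (Suc m)) (mix_conv m q)) x))"
    using distributed_convolution[OF ind last sum] by (simp add: ME_convolution[OF \<beta> mix(2,1)])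
  then show ?case
    unfolding m mix_conv_Suc[abs_def] conv_vector_commute[of _ "q (Suc (Suc m'))"]
    by (simp add: distributed_def ME_def add.commute cong: distr_cong)
qed

section \<open>Products of mixed Erlang laws\<close>

lemma PiM_density:
  fixes f :: "'i \<Rightarrow> real \<Rightarrow> ennreal"
  assumes I: "finite I" and f [measurable]: "\<And>i. f i \<in> borel_measurable borel"
    and prob: "\<And>i. prob_space (density lborel (f i))"
  shows "PiM I (\<lambda>i. density lborel (f i)) = density (PiM I (\<lambda>_. lborel)) (\<lambda>x. \<Prod>i\<in>I. f i (x i))"
proof -
  interpret L: product_sigma_finite "\<lambda>_::'i. lborel :: real measure" ..
  interpret D: product_prob_space "\<lambda>i. density lborel (f i)"
    by (rule product_prob_spaceI) (rule prob)
  show ?thesis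
  proof (rule D.PiM_eqI[OF I, symmetric])
    show "sets (density (PiM I (\<lambda>_. lborel)) (\<lambda>x. \<Prod>i\<in>I. f i (x i))) = sets (PiM I (\<lambda>i. density lborel (f i)))"
      by (simp cong: sets_PiM_cong)
    fix A assume A: "\<And>i. i \<in> I \<Longrightarrow> A i \<in> sets (density lborel (f i))"
    then have [measurable]: "i \<in> I \<Longrightarrow> A i \<in> sets borel" for i by simp
    have "emeasure (density (PiM I (\<lambda>_. lborel)) (\<lambda>x. \<Prod>i\<in>I. f i (x i))) (Pi\<^sub>E I A)
      = (\<integral>\<^sup>+x. (\<Prod>i\<in>I. f i (x i)) * indicator (Pi\<^sub>E I A) x \<partial>PiM I (\<lambda>_. lborel))"
      using A by (intro emeasure_density) (auto intro!: sets_PiM_I_finite I)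
    also have "\<dots> = (\<integral>\<^sup>+x. (\<Prod>i\<in>I. f i (x i) * indicator (A i) (x i)) \<partial>PiM I (\<lambda>_. lborel))"
    proof (rule nn_integral_cong)
      fix x :: "'i \<Rightarrow> real" assume "x \<in> space (PiM I (\<lambda>_. lborel))"
      then have "x \<in> Pi\<^sub>E I A \<longleftrightarrow> (\<forall>i\<in>I. x i \<in> A i)"
        by (auto simp: space_PiM PiE_iff)
      then have "indicator (Pi\<^sub>E I A) x = (\<Prod>i\<in>I. indicator (A i) (x i) :: ennreal)"
        using I by (auto simp: indicator_def prod_zero_iff)
      then show "(\<Prod>i\<in>I. f i (x i)) * indicator (Pi\<^sub>E I A) x = (\<Prod>i\<in>I. f i (x i) * indicator (A i) (x i))"
        by (simp add: prod.distrib)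
    qed
    also have "\<dots> = (\<Prod>i\<in>I. \<integral>\<^sup>+x. f i x * indicator (A i) x \<partial>lborel)"
      using I by (intro L.product_nn_integral_prod) auto
    also have "\<dots> = (\<Prod>i\<in>I. emeasure (density lborel (f i)) (A i))"
      by (intro prod.cong refl emeasure_density[symmetric]) auto
    finally show "emeasure (density (PiM I (\<lambda>_. lborel)) (\<lambda>x. \<Prod>i\<in>I. f i (x i))) (Pi\<^sub>E I A)
      = (\<Prod>i\<in>I. emeasure (density lborel (f i)) (A i))" .
  qed
qed

lemma PiM_ME:
  assumes "finite C" "0 < \<beta>" "\<And>c. mixing_vector (q c)"
  shows "PiM C (\<lambda>c. ME \<beta> (q c)) = density (PiM C (\<lambda>_. lborel)) (\<lambda>x. ennreal (\<Prod>c\<in>C. ME_pdf \<beta> (q c) (x c)))"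
proof -
  have "PiM C (\<lambda>c. ME \<beta> (q c)) = density (PiM C (\<lambda>_. lborel)) (\<lambda>x. \<Prod>c\<in>C. ennreal (ME_pdf \<beta> (q c) (x c)))"
    unfolding ME_def using assms prob_space_ME[unfolded ME_def] by (intro PiM_density) auto
  then show ?thesis
    using assms by (simp add: prod_ennreal ME_pdf_nonneg)
qed

text \<open>
  The portfolios use disjoint blocks of coordinates of the product space, hence their sums are
  independent; each sum has the convolved law.
\<close>

lemma distr_portfolio_sums:
  fixes k :: "nat \<Rightarrow> nat" and I :: "nat set"
  defines "C \<equiv> SIGMA i:I. {1..k i}"
  assumes \<beta>: "0 < \<beta>" and q: "\<And>c. mixing_vector (q c)"
    and I: "finite I" "I \<noteq> {}" and k: "\<And>i. i \<in> I \<Longrightarrow> 1 \<le> k i"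
  shows "distr (PiM C (\<lambda>c. ME \<beta> (q c))) (PiM I (\<lambda>_. borel)) (\<lambda>x. \<lambda>i\<in>I. \<Sum>j=1..k i. x (i, j))
    = PiM I (\<lambda>i. ME \<beta> (mix_conv (k i) (\<lambda>j. q (i, j))))"
proof -
  let ?P = "PiM C (\<lambda>c. ME \<beta> (q c))"
  have pME: "prob_space (ME \<beta> (q c))" for c using prob_space_ME[OF \<beta> q] .
  interpret prob_space ?P by (rule prob_space_PiM) (rule pME)
  have C: "C \<noteq> {}"
  proof -
    obtain i where "i \<in> I" using I by auto
    then have "(i, 1) \<in> C" using k by (auto simp: C_def)
    then show ?thesis by auto
  qed
  have comp [measurable]: "(\<lambda>x. x c) \<in> borel_measurable ?P" if "c \<in> C" for c
    using measurable_component_singleton[OF that, of "\<lambda>c. ME \<beta> (q c)"] by (simp cong: measurable_cong_sets)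
  have marginal: "distr ?P borel (\<lambda>x. x c) = ME \<beta> (q c)" if "c \<in> C" for c
    using distr_PiM_component[OF pME that] by (simp cong: distr_cong)
  have "indep_vars (\<lambda>_. borel) (\<lambda>c x. x c) C"
  proof (subst indep_vars_iff_distr_eq_PiM'[OF C])
    have "distr ?P (PiM C (\<lambda>_. borel)) (\<lambda>x. \<lambda>c\<in>C. x c) = distr ?P ?P (\<lambda>x. x)"
      by (intro distr_cong refl sets_PiM_cong) (auto simp: space_PiM PiE_restrict restrict_PiE_iff)
    also have "\<dots> = PiM C (\<lambda>c. distr ?P borel (\<lambda>x. x c))"
      using marginal by (simp add: distr_id cong: PiM_cong)
    finally show "distr ?P (PiM C (\<lambda>_. borel)) (\<lambda>x. \<lambda>c\<in>C. x c) = PiM C (\<lambda>c. distr ?P borel (\<lambda>x. x c))" .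
  qed (rule comp)
  note ind = this
  have "indep_vars (\<lambda>i. PiM ({i} \<times> {1..k i}) (\<lambda>_. borel)) (\<lambda>i x. restrict x ({i} \<times> {1..k i})) I"
    using indep_vars_restrict[OF ind, of I "\<lambda>i. {i} \<times> {1..k i}"]
    by (auto simp: C_def disjoint_family_on_def)
  then have "indep_vars (\<lambda>_. borel) (\<lambda>i. (\<lambda>x. \<Sum>j=1..k i. x (i, j)) \<circ> (\<lambda>x. restrict x ({i} \<times> {1..k i}))) I"
    by (rule indep_vars_compose) measurable
  then have indS: "indep_vars (\<lambda>_. borel) (\<lambda>i x. \<Sum>j=1..k i. x (i, j)) I"
    by (simp add: comp_def)
  then have rv: "random_variable borel (\<lambda>x. \<Sum>j=1..k i. x (i, j))" if "i \<in> I" for i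
    using that by (auto simp: indep_vars_def)
  have law: "distr ?P borel (\<lambda>x. \<Sum>j=1..k i. x (i, j)) = ME \<beta> (mix_conv (k i) (\<lambda>j. q (i, j)))"
    if i: "i \<in> I" for i
  proof (rule distr_sum_ME[OF \<beta> k[OF i] _ q])
    have sub: "Pair i ` {1..k i} \<subseteq> C" using i by (auto simp: C_def)
    show "indep_vars (\<lambda>_. borel) (\<lambda>j x. x (i, j)) {1..k i}"
      by (rule indep_vars_reindex[OF _ indep_vars_subset[OF ind sub]]) (simp add: inj_on_def)
    show "distr ?P borel (\<lambda>x. x (i, j)) = ME \<beta> (q (i, j))" if "j \<in> {1..k i}" for j
      using that i by (intro marginal) (auto simp: C_def)
  qed
  have "distr ?P (PiM I (\<lambda>_. borel)) (\<lambda>x. \<lambda>i\<in>I. \<Sum>j=1..k i. x (i, j))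
      = PiM I (\<lambda>i. distr ?P borel (\<lambda>x. \<Sum>j=1..k i. x (i, j)))"
    using indS indep_vars_iff_distr_eq_PiM'[OF I(2) rv] by simp
  also have "\<dots> = PiM I (\<lambda>i. ME \<beta> (mix_conv (k i) (\<lambda>j. q (i, j))))"
    by (intro PiM_cong refl law)
  finally show ?thesis .
qed

section \<open>Erlang laws\<close>

text \<open>
  Shape 0 is the point mass at 0. With it the Erlang laws of a fixed scale form a convolution
  semigroup, and the law of a stop-loss payment, which has an atom at 0, is a mixture of them.
\<close>

definition Erl :: "real \<Rightarrow> nat \<Rightarrow> real measure" where
  "Erl \<beta> k = (if k = 0 then return borel 0 else density lborel (\<lambda>x. ennreal (w k x \<beta>)))"

lemma sets_Erl [simp, measurable_cong]: "sets (Erl \<beta> k) = sets borel"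
  by (simp add: Erl_def)

lemma space_Erl [simp]: "space (Erl \<beta> k) = UNIV"
  by (simp add: Erl_def)

lemma nn_integral_Erl_0:
  "G \<in> borel_measurable borel \<Longrightarrow> (\<integral>\<^sup>+x. G x \<partial>Erl \<beta> 0) = G 0"
  by (simp add: Erl_def nn_integral_return)

lemma nn_integral_Erl_Suc:
  "G \<in> borel_measurable borel \<Longrightarrow>
    (\<integral>\<^sup>+x. G x \<partial>Erl \<beta> (Suc k)) = (\<integral>\<^sup>+x. ennreal (w (Suc k) x \<beta>) * G x \<partial>lborel)"
  by (simp add: Erl_def nn_integral_density)

lemma prob_space_Erl:
  assumes "0 < \<beta>" shows "prob_space (Erl \<beta> k)"
proof (cases k)
  case (Suc k')
  show ?thesis
    using nn_integral_w[OF assms, of k'] by (intro prob_spaceI) (simp add: Suc Erl_def emeasure_density)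
qed (auto simp: Erl_def intro: prob_space_return)

lemma nn_integral_Erl_add:
  assumes \<beta>: "0 < \<beta>" and [measurable]: "G \<in> borel_measurable borel"
  shows "(\<integral>\<^sup>+x. (\<integral>\<^sup>+y. G (x + y) \<partial>Erl \<beta> b) \<partial>Erl \<beta> a) = (\<integral>\<^sup>+x. G x \<partial>Erl \<beta> (a + b))"
proof -
  interpret b: prob_space "Erl \<beta> b" using \<beta> by (rule prob_space_Erl)
  consider "a = 0" | "b = 0" | i j where "a = Suc i" "b = Suc j"
    by (metis not0_implies_Suc)
  then show ?thesis
  proof cases
    case 1
    then show ?thesis by (simp add: nn_integral_Erl_0)
  next
    case 2
    then show ?thesis by (simp add: nn_integral_Erl_0)
  next
    case 3
    have "(\<integral>\<^sup>+x. (\<integral>\<^sup>+y. G (x + y) \<partial>Erl \<beta> b) \<partial>Erl \<beta> a)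
      = (\<integral>\<^sup>+x. (\<integral>\<^sup>+y. ennreal (w (Suc i) x \<beta>) * (ennreal (w (Suc j) y \<beta>) * G (x + y)) \<partial>lborel) \<partial>lborel)"
      unfolding 3 by (simp add: nn_integral_Erl_Suc nn_integral_cmult)
    also have "\<dots> = (\<integral>\<^sup>+y. (\<integral>\<^sup>+x. ennreal (w (Suc i) x \<beta>) * (ennreal (w (Suc j) y \<beta>) * G (x + y)) \<partial>lborel) \<partial>lborel)"
      by (intro lborel_pair.Fubini') measurable
    also have "\<dots> = (\<integral>\<^sup>+y. (\<integral>\<^sup>+x. ennreal (w (Suc i) (x - y) \<beta>) * (ennreal (w (Suc j) y \<beta>) * G x) \<partial>lborel) \<partial>lborel)"
    proof (rule nn_integral_cong)
      fix y
      show "(\<integral>\<^sup>+x. ennreal (w (Suc i) x \<beta>) * (ennreal (w (Suc j) y \<beta>) * G (x + y)) \<partial>lborel)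
          = (\<integral>\<^sup>+x. ennreal (w (Suc i) (x - y) \<beta>) * (ennreal (w (Suc j) y \<beta>) * G x) \<partial>lborel)"
        using nn_integral_real_affine[of "\<lambda>x. ennreal (w (Suc i) (x - y) \<beta>) * (ennreal (w (Suc j) y \<beta>) * G x)" 1 y]
        by (simp add: add.commute)
    qed
    also have "\<dots> = (\<integral>\<^sup>+x. (\<integral>\<^sup>+y. ennreal (w (Suc i) (x - y) \<beta>) * (ennreal (w (Suc j) y \<beta>) * G x) \<partial>lborel) \<partial>lborel)"
      by (intro lborel_pair.Fubini') measurable
    also have "\<dots> = (\<integral>\<^sup>+x. (\<integral>\<^sup>+y. ennreal (w (Suc i) (x - y) \<beta>) * ennreal (w (Suc j) y \<beta>) \<partial>lborel) * G x \<partial>lborel)"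
      by (simp add: nn_integral_multc mult.assoc[symmetric])
    also have "\<dots> = (\<integral>\<^sup>+x. G x \<partial>Erl \<beta> (a + b))"
      unfolding w_convolution[OF \<beta>] by (simp add: 3 nn_integral_Erl_Suc)
    finally show ?thesis .
  qed
qed

text \<open>The shape is positive here: \<^const>\<open>Wbar\<close> with index 0 is an empty sum.\<close>

lemma Erl_tail:
  assumes \<beta>: "0 < \<beta>" and y: "0 \<le> y"
  shows "(\<integral>\<^sup>+z. indicator {y<..} z \<partial>Erl \<beta> (Suc m)) = ennreal (Wbar (Suc m) y \<beta>)"
proof -
  interpret prob_space "Erl \<beta> (Suc m)" using \<beta> by (rule prob_space_Erl)
  have "emeasure (Erl \<beta> (Suc m)) {..y} = ennreal (erlang_CDF m \<beta> y)"
    using emeasure_erlang_density[OF \<beta>, of m y] by (simp add: Erl_def w_Suc)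
  then have "prob {..y} = erlang_CDF m \<beta> y"
    using \<beta> by (simp add: emeasure_eq_measure)
  moreover have "{y<..} = space (Erl \<beta> (Suc m)) - {..y}" by auto
  ultimately have "prob {y<..} = 1 - erlang_CDF m \<beta> y"
    using prob_compl[of "{..y}"] by simp
  also have "\<dots> = Wbar (Suc m) y \<beta>"
    using y by (simp add: erlang_CDF_def Wbar_def lessThan_Suc_atMost sum_distrib_left field_simps)
  finally show ?thesis by (simp add: emeasure_eq_measure)
qed

text \<open>
  Size-biasing raises the shape of an Erlang law by one. For shape 0 both sides vanish, as \<open>t = 0\<close>
  almost surely.
\<close>

lemma nn_integral_Erl_times:
  assumes \<beta>: "0 < \<beta>" and [measurable]: "G \<in> borel_measurable borel"
  shows "(\<integral>\<^sup>+t. ennreal t * G t \<partial>Erl \<beta> a) = ennreal (real a / \<beta>) * (\<integral>\<^sup>+t. G t \<partial>Erl \<beta> (Suc a))"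
proof (cases a)
  case 0
  then show ?thesis by (simp add: nn_integral_Erl_0)
next
  case (Suc m)
  have "w (Suc m) t \<beta> * t = real (Suc m) / \<beta> * w (Suc (Suc m)) t \<beta>" for t
    using \<beta> by (simp add: w_def erlang_density_def divide_simps del: of_nat_Suc)
  moreover have "ennreal (w (Suc m) t \<beta>) * ennreal t = ennreal (w (Suc m) t \<beta> * t)" for t
    using \<beta> by (cases "0 \<le> t") (auto simp: w_neg ennreal_mult)
  ultimately have "ennreal (w (Suc m) t \<beta>) * ennreal t = ennreal (real (Suc m) / \<beta> * w (Suc (Suc m)) t \<beta>)" for t
    by metis
  moreover have "ennreal (real (Suc m) / \<beta> * w (Suc (Suc m)) t \<beta>)
      = ennreal (real (Suc m) / \<beta>) * ennreal (w (Suc (Suc m)) t \<beta>)" for t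
    by (rule ennreal_mult) (use \<beta> in simp_all)
  ultimately have "ennreal (w (Suc m) t \<beta>) * ennreal t = ennreal (real (Suc m) / \<beta>) * ennreal (w (Suc (Suc m)) t \<beta>)" for t
    by metis
  then have "ennreal (w (Suc m) t \<beta>) * (ennreal t * G t)
      = ennreal (real (Suc m) / \<beta>) * (ennreal (w (Suc (Suc m)) t \<beta>) * G t)" for t
    by (simp only: mult.assoc[symmetric])
  then show ?thesis
    by (simp add: Suc nn_integral_Erl_Suc nn_integral_cmult del: of_nat_Suc)
qed

section \<open>The law of a stop-loss payment\<close>

text \<open>
  The binomial theorem for \<open>(d + t) ^ k\<close>: seen as the \<open>(k + 1)\<close>-st point of a Poisson process, the
  Erlang variable leaves \<open>j\<close> points before \<open>d\<close> and \<open>k - j + 1\<close> points to wait for after \<open>d\<close>.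
\<close>

lemma w_add:
  assumes "0 < \<beta>" "0 \<le> d" "0 \<le> t"
  shows "w (Suc k) (d + t) \<beta> = (\<Sum>j\<le>k. 1 / \<beta> * w (Suc j) d \<beta> * w (Suc (k - j)) t \<beta>)"
proof -
  have "w (Suc k) (d + t) \<beta> = \<beta> ^ Suc k * exp (- \<beta> * (d + t)) / fact k * (d + t) ^ k"
    using assms by (simp add: w_def erlang_density_def)
  also have "\<dots> = (\<Sum>j\<le>k. 1 / \<beta> * w (Suc j) d \<beta> * w (Suc (k - j)) t \<beta>)"
    unfolding binomial_ring sum_distrib_left
  proof (rule sum.cong)
    fix j assume "j \<in> {..k}"
    then have j: "j \<le> k" by simp
    then have "\<beta> ^ k = \<beta> ^ j * \<beta> ^ (k - j)" by (simp add: power_add[symmetric])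
    moreover have "real (k choose j) = fact k / (fact j * fact (k - j))" by (rule binomial_fact[OF j])
    ultimately show "\<beta> ^ Suc k * exp (- \<beta> * (d + t)) / fact k * (of_nat (k choose j) * d ^ j * t ^ (k - j))
        = 1 / \<beta> * w (Suc j) d \<beta> * w (Suc (k - j)) t \<beta>"
      using assms by (simp add: w_def erlang_density_def ring_distribs exp_add[symmetric] exp_diff exp_minus field_simps)
  qed simp
  finally show ?thesis .
qed

lemma Delta_nonneg:
  assumes "0 < \<beta>" "mixing_vector q"
  shows "0 \<le> \<Delta> h d \<beta> q"
    and "ennreal (\<Delta> h d \<beta> q) = (\<Sum>j. ennreal (q (Suc (j + h))) * ennreal (1 / \<beta> * w (Suc j) d \<beta>))"
proof -
  note q = mixing_vectorD[OF assms(2)]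
  have t0: "0 \<le> q (Suc (j + h)) * (1 / \<beta> * w (Suc j) d \<beta>)" for j
    using assms(1) q(1) by simp
  have "1 / \<beta> * w (Suc j) d \<beta> \<le> 1" for j
    using w_le[OF assms(1), of "Suc j" d] assms(1) by (simp add: field_simps)
  then have t1: "q (Suc (j + h)) * (1 / \<beta> * w (Suc j) d \<beta>) \<le> q (Suc (j + h))" for j
    using mult_left_mono[OF _ q(1)] by fastforce
  have s: "summable (\<lambda>j. q (Suc (j + h)) * (1 / \<beta> * w (Suc j) d \<beta>))"
    by (rule summable_comparison_test'[OF summable_ignore_initial_segment[OF q(2), of h], of 0])
       (simp only: real_norm_def abs_of_nonneg[OF t0] t1)
  have s': "summable (\<lambda>j. q (Suc (j + h)) * w (Suc j) d \<beta>)"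
    using summable_mult[OF s, of \<beta>] assms(1) by simp
  have \<Delta>: "\<Delta> h d \<beta> q = (\<Sum>j. q (Suc (j + h)) * (1 / \<beta> * w (Suc j) d \<beta>))"
    using suminf_mult[OF s', of "1 / \<beta>"] by (simp add: \<Delta>_def mult_ac)
  show "0 \<le> \<Delta> h d \<beta> q"
    unfolding \<Delta> by (rule suminf_nonneg[OF s t0])
  show "ennreal (\<Delta> h d \<beta> q) = (\<Sum>j. ennreal (q (Suc (j + h))) * ennreal (1 / \<beta> * w (Suc j) d \<beta>))"
    unfolding \<Delta> suminf_ennreal2[OF t0 s, symmetric] using assms(1) q by (intro suminf_cong ennreal_mult) simp_all
qed

text \<open>So \<open>\<Delta> h\<close> is the probability that \<open>d\<close> is exceeded and \<open>h + 1\<close> exponential phases remain at \<open>d\<close>.\<close>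

lemma ME_pdf_add:
  assumes \<beta>: "0 < \<beta>" and q: "mixing_vector q" and d: "0 \<le> d" and t: "0 \<le> t"
  shows "ennreal (ME_pdf \<beta> q (d + t)) = (\<Sum>h. ennreal (\<Delta> h d \<beta> q) * ennreal (w (Suc h) t \<beta>))"
proof -
  have "ennreal (ME_pdf \<beta> q (d + t)) = (\<Sum>k. \<Sum>j\<le>k. ennreal (q (Suc (j + (k - j)))) *
      ennreal (1 / \<beta> * w (Suc j) d \<beta>) * ennreal (w (Suc (k - j)) t \<beta>))"
    unfolding ennreal_ME_pdf[OF \<beta> q]
  proof (rule suminf_cong)
    fix k
    have "ennreal (w (Suc k) (d + t) \<beta>) = (\<Sum>j\<le>k. ennreal (1 / \<beta> * w (Suc j) d \<beta> * w (Suc (k - j)) t \<beta>))"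
      unfolding w_add[OF \<beta> d t] using \<beta> by (intro sum_ennreal[symmetric]) simp
    also have "\<dots> = (\<Sum>j\<le>k. ennreal (1 / \<beta> * w (Suc j) d \<beta>) * ennreal (w (Suc (k - j)) t \<beta>))"
      using \<beta> by (intro sum.cong refl ennreal_mult) simp_all
    finally show "ennreal (q (Suc k)) * ennreal (w (Suc k) (d + t) \<beta>)
      = (\<Sum>j\<le>k. ennreal (q (Suc (j + (k - j)))) * ennreal (1 / \<beta> * w (Suc j) d \<beta>) * ennreal (w (Suc (k - j)) t \<beta>))"
      by (simp add: sum_distrib_left mult.assoc)
  qed
  also have "\<dots> = (\<Sum>h. \<Sum>j. ennreal (q (Suc (j + h))) *
      ennreal (1 / \<beta> * w (Suc j) d \<beta>) * ennreal (w (Suc h) t \<beta>))"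
    by (rule trans[OF suminf_triangle_ennreal[symmetric, where F="\<lambda>j h. ennreal (q (Suc (j + h))) *
      ennreal (1 / \<beta> * w (Suc j) d \<beta>) * ennreal (w (Suc h) t \<beta>)"] suminf_swap_ennreal])
  also have "\<dots> = (\<Sum>h. ennreal (\<Delta> h d \<beta> q) * ennreal (w (Suc h) t \<beta>))"
    unfolding ennreal_suminf_multc Delta_nonneg(2)[OF \<beta> q] ..
  finally show ?thesis .
qed

text \<open>The weight of the Erlang law of shape \<open>h\<close> in the law of the payment \<open>(S - d)\<^sub>+\<close>.\<close>

definition stop_weight :: "real \<Rightarrow> real \<Rightarrow> (nat \<Rightarrow> real) \<Rightarrow> nat \<Rightarrow> real" where
  "stop_weight d \<beta> q h = (case h of 0 \<Rightarrow> cdf (ME \<beta> q) d | Suc h' \<Rightarrow> \<Delta> h' d \<beta> q)"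

lemma stop_weight_nonneg: "0 < \<beta> \<Longrightarrow> mixing_vector q \<Longrightarrow> 0 \<le> stop_weight d \<beta> q h"
  by (auto simp: stop_weight_def cdf_def Delta_nonneg split: nat.split)

lemma stop_weight_simps [simp]:
  "stop_weight d \<beta> q 0 = cdf (ME \<beta> q) d" "stop_weight d \<beta> q (Suc h) = \<Delta> h d \<beta> q"
  by (auto simp: stop_weight_def)

lemma nn_integral_stop_loss:
  assumes \<beta>: "0 < \<beta>" and q: "mixing_vector q" and d: "0 \<le> d" and [measurable]: "G \<in> borel_measurable borel"
  shows "(\<integral>\<^sup>+s. G (max 0 (s - d)) \<partial>ME \<beta> q)
    = (\<Sum>h. ennreal (stop_weight d \<beta> q h) * (\<integral>\<^sup>+t. G t \<partial>Erl \<beta> h))"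
proof -
  interpret prob_space "ME \<beta> q" using \<beta> q by (rule prob_space_ME)
  have "(\<integral>\<^sup>+s. G (max 0 (s - d)) \<partial>ME \<beta> q)
    = (\<integral>\<^sup>+s. G 0 * indicator {..d} s + G (s - d) * indicator {d<..} s \<partial>ME \<beta> q)"
    by (intro nn_integral_cong) (auto split: split_indicator)
  also have "\<dots> = G 0 * ennreal (cdf (ME \<beta> q) d) + (\<integral>\<^sup>+s. G (s - d) * indicator {d<..} s \<partial>ME \<beta> q)"
    by (subst nn_integral_add) (auto simp: nn_integral_cmult cdf_def emeasure_eq_measure)
  also have "(\<integral>\<^sup>+s. G (s - d) * indicator {d<..} s \<partial>ME \<beta> q)
    = (\<integral>\<^sup>+s. ennreal (ME_pdf \<beta> q s) * (G (s - d) * indicator {d<..} s) \<partial>lborel)"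
    unfolding ME_def by (subst nn_integral_density) auto
  also have "\<dots> = (\<integral>\<^sup>+t. ennreal (ME_pdf \<beta> q (d + t)) * (G t * indicator {0<..} t) \<partial>lborel)"
    by (subst nn_integral_real_affine[where c=1 and t=d]) (auto simp: indicator_def)
  also have "\<dots> = (\<integral>\<^sup>+t. (\<Sum>h. ennreal (\<Delta> h d \<beta> q) * (ennreal (w (Suc h) t \<beta>) * G t)) \<partial>lborel)"
  proof (rule nn_integral_cong_AE)
    have "AE t in lborel. t \<noteq> (0::real)" by (rule AE_lborel_singleton)
    then show "AE t in lborel. ennreal (ME_pdf \<beta> q (d + t)) * (G t * indicator {0<..} t)
        = (\<Sum>h. ennreal (\<Delta> h d \<beta> q) * (ennreal (w (Suc h) t \<beta>) * G t))"
    proof eventually_elim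
      fix t :: real assume "t \<noteq> 0"
      then consider "t < 0" | "0 < t" by linarith
      then show "ennreal (ME_pdf \<beta> q (d + t)) * (G t * indicator {0<..} t)
          = (\<Sum>h. ennreal (\<Delta> h d \<beta> q) * (ennreal (w (Suc h) t \<beta>) * G t))"
        by cases (simp_all add: w_neg ME_pdf_add[OF \<beta> q d] ennreal_suminf_multc[symmetric] mult.assoc)
    qed
  qed
  also have "\<dots> = (\<Sum>h. ennreal (\<Delta> h d \<beta> q) * (\<integral>\<^sup>+t. G t \<partial>Erl \<beta> (Suc h)))"
    by (simp add: nn_integral_suminf nn_integral_cmult nn_integral_Erl_Suc)
  also have "G 0 * ennreal (cdf (ME \<beta> q) d) + \<dots>
    = (\<Sum>h. ennreal (stop_weight d \<beta> q h) * (\<integral>\<^sup>+t. G t \<partial>Erl \<beta> h))"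
    using suminf_offset[of "\<lambda>h. ennreal (stop_weight d \<beta> q h) * (\<integral>\<^sup>+t. G t \<partial>Erl \<beta> h)" 1]
    by (simp add: nn_integral_Erl_0 mult.commute)
  finally show ?thesis .
qed

section \<open>The tail expectation for independent portfolios\<close>

lemma nn_integral_PiE_insert:
  fixes F :: "('i \<Rightarrow> nat) \<Rightarrow> ennreal"
  assumes K: "finite K" "i \<notin> K"
  shows "(\<integral>\<^sup>+h. F h \<partial>count_space (PiE (insert i K) (\<lambda>_. UNIV)))
    = (\<integral>\<^sup>+h. (\<Sum>a. F (h(i := a))) \<partial>count_space (PiE K (\<lambda>_. UNIV)))"
proof -
  let ?A = "PiE K (\<lambda>_. UNIV :: nat set)"
  have cnt: "countable ?A" using K by (intro countable_PiE) auto
  interpret N: sigma_finite_measure "count_space (UNIV :: nat set)"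
    by (rule sigma_finite_measure_count_space_countable) simp
  have "inj_on (\<lambda>(h, a). h(i := a)) (?A \<times> UNIV)"
  proof (rule inj_onI, clarify)
    fix h h' :: "'i \<Rightarrow> nat" and a a'
    assume h: "h \<in> ?A" "h' \<in> ?A" and eq: "h(i := a) = h'(i := a')"
    have "h j = h' j" for j
      using h K fun_cong[OF eq, of j] by (cases "j = i") (auto simp: PiE_iff extensional_def)
    then show "h = h' \<and> a = a'"
      using fun_cong[OF eq, of i] by auto
  qed
  moreover have "(\<lambda>(h, a). h(i := a)) ` (?A \<times> UNIV) = PiE (insert i K) (\<lambda>_. UNIV)"
    unfolding PiE_insert_eq by (force simp: image_iff)
  ultimately have bij: "bij_betw (\<lambda>(h, a). h(i := a)) (?A \<times> UNIV) (PiE (insert i K) (\<lambda>_. UNIV))"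
    by (simp add: bij_betw_def)
  have "(\<integral>\<^sup>+h. F h \<partial>count_space (PiE (insert i K) (\<lambda>_. UNIV)))
      = (\<integral>\<^sup>+p. F (case p of (h, a) \<Rightarrow> h(i := a)) \<partial>count_space (?A \<times> UNIV))"
    by (rule nn_integral_bij_count_space[OF bij, symmetric])
  also have "\<dots> = (\<integral>\<^sup>+p. F (case p of (h, a) \<Rightarrow> h(i := a)) \<partial>(count_space ?A \<Otimes>\<^sub>M count_space UNIV))"
    using cnt by (simp add: pair_measure_countable)
  also have "\<dots> = (\<integral>\<^sup>+h. (\<integral>\<^sup>+a. F (h(i := a)) \<partial>count_space UNIV) \<partial>count_space ?A)"
    using cnt by (subst N.nn_integral_fst[symmetric]) (auto simp: pair_measure_countable)
  finally show ?thesis by (simp add: nn_integral_count_space_nat)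
qed

lemma prod_fun_upd_notin:
  "i \<notin> K \<Longrightarrow> (\<Prod>j\<in>K. f j ((h(i := a)) j)) = (\<Prod>j\<in>K. f j (h j))"
  by (rule prod.cong) auto

lemma sum_fun_upd_notin:
  "i \<notin> K \<Longrightarrow> (\<Sum>j\<in>K. f j ((h(i := a)) j)) = (\<Sum>j\<in>K. f j (h j))"
  by (rule sum.cong) auto

text \<open>
  Expand every payment into its mixture of Erlang laws and add the shapes by the semigroup property.
  The induction is over the set of portfolios, and the function \<open>G\<close> has to be arbitrary: the payment
  that is split off is absorbed into the function for the remaining ones.
\<close>

lemma nn_integral_sum_stop_loss:
  fixes d :: "'i \<Rightarrow> real"
  assumes \<beta>: "0 < \<beta>" and P: "\<And>i. mixing_vector (P i)" and K: "finite K" and d: "\<And>i. i \<in> K \<Longrightarrow> 0 \<le> d i"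
    and G: "G \<in> borel_measurable borel"
  shows "(\<integral>\<^sup>+s. G (\<Sum>i\<in>K. max 0 (s i - d i)) \<partial>PiM K (\<lambda>i. ME \<beta> (P i)))
    = (\<integral>\<^sup>+h. (\<Prod>i\<in>K. ennreal (stop_weight (d i) \<beta> (P i) (h i))) * (\<integral>\<^sup>+z. G z \<partial>Erl \<beta> (\<Sum>i\<in>K. h i))
        \<partial>count_space (PiE K (\<lambda>_. UNIV)))"
  using K d G
proof (induction K arbitrary: G rule: finite_induct)
  case empty
  then show ?case
    by (simp add: nn_integral_Erl_0 PiM_empty nn_integral_count_space_finite)
next
  case (insert i K)
  interpret product_sigma_finite "\<lambda>i. ME \<beta> (P i)"
    by (rule product_sigma_finite.intro) (rule prob_space_imp_sigma_finite[OF prob_space_ME[OF \<beta> P]])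
  interpret E: prob_space "Erl \<beta> a" for a using \<beta> by (rule prob_space_Erl)
  note [measurable] = insert.prems(2)
  \<comment> \<open>\<open>G' r\<close> averages \<open>G (r + T)\<close> over the payment \<open>T\<close> of portfolio \<open>i\<close>.\<close>
  define G' where "G' r = (\<Sum>a. ennreal (stop_weight (d i) \<beta> (P i) a) * (\<integral>\<^sup>+t. G (r + t) \<partial>Erl \<beta> a))" for r
  have [measurable]: "G' \<in> borel_measurable borel"
    unfolding G'_def[abs_def] by measurable
  have [measurable]: "(\<lambda>x. \<Sum>j\<in>insert i K. max 0 (x j - d j)) \<in> borel_measurable (PiM (insert i K) (\<lambda>i. ME \<beta> (P i)))"
    by measurable
  have "(\<integral>\<^sup>+s. G (\<Sum>j\<in>insert i K. max 0 (s j - d j)) \<partial>PiM (insert i K) (\<lambda>i. ME \<beta> (P i)))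
    = (\<integral>\<^sup>+s. (\<integral>\<^sup>+y. G (\<Sum>j\<in>insert i K. max 0 ((s(i := y)) j - d j)) \<partial>ME \<beta> (P i)) \<partial>PiM K (\<lambda>i. ME \<beta> (P i)))"
    using insert.hyps by (intro product_nn_integral_insert) measurable
  also have "\<dots> = (\<integral>\<^sup>+s. (\<integral>\<^sup>+y. G ((\<Sum>j\<in>K. max 0 (s j - d j)) + max 0 (y - d i)) \<partial>ME \<beta> (P i)) \<partial>PiM K (\<lambda>i. ME \<beta> (P i)))"
    using insert.hyps sum_fun_upd_notin[OF insert.hyps(2), of "\<lambda>j x. max 0 (x - d j)"]
    by (simp add: add.commute)
  also have "\<dots> = (\<integral>\<^sup>+s. G' (\<Sum>j\<in>K. max 0 (s j - d j)) \<partial>PiM K (\<lambda>i. ME \<beta> (P i)))"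
    unfolding G'_def using insert.prems by (subst nn_integral_stop_loss[OF \<beta> P]) auto
  also have "\<dots> = (\<integral>\<^sup>+h. (\<Prod>j\<in>K. ennreal (stop_weight (d j) \<beta> (P j) (h j))) * (\<integral>\<^sup>+z. G' z \<partial>Erl \<beta> (\<Sum>j\<in>K. h j))
        \<partial>count_space (PiE K (\<lambda>_. UNIV)))"
    using insert.prems by (intro insert.IH) auto
  also have "\<dots> = (\<integral>\<^sup>+h. (\<Sum>a. (\<Prod>j\<in>insert i K. ennreal (stop_weight (d j) \<beta> (P j) ((h(i := a)) j)))
        * (\<integral>\<^sup>+z. G z \<partial>Erl \<beta> (\<Sum>j\<in>insert i K. (h(i := a)) j))) \<partial>count_space (PiE K (\<lambda>_. UNIV)))"
  proof (rule nn_integral_cong)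
    fix h
    have "(\<integral>\<^sup>+z. G' z \<partial>Erl \<beta> (\<Sum>j\<in>K. h j))
        = (\<Sum>a. ennreal (stop_weight (d i) \<beta> (P i) a) * (\<integral>\<^sup>+z. G z \<partial>Erl \<beta> ((\<Sum>j\<in>K. h j) + a)))"
      unfolding G'_def
      by (simp add: nn_integral_suminf nn_integral_cmult nn_integral_Erl_add[OF \<beta>])
    then show "(\<Prod>j\<in>K. ennreal (stop_weight (d j) \<beta> (P j) (h j))) * (\<integral>\<^sup>+z. G' z \<partial>Erl \<beta> (\<Sum>j\<in>K. h j))
      = (\<Sum>a. (\<Prod>j\<in>insert i K. ennreal (stop_weight (d j) \<beta> (P j) ((h(i := a)) j)))
        * (\<integral>\<^sup>+z. G z \<partial>Erl \<beta> (\<Sum>j\<in>insert i K. (h(i := a)) j)))"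
      using insert.hyps prod_fun_upd_notin[OF insert.hyps(2), of "\<lambda>j x. ennreal (stop_weight (d j) \<beta> (P j) x)"]
        sum_fun_upd_notin[OF insert.hyps(2), where f="\<lambda>j x. x" and h="h :: _ \<Rightarrow> nat" for h]
      by (simp only: ennreal_suminf_cmult[symmetric])
         (auto intro!: suminf_cong simp: add.commute mult_ac)
  qed
  also have "\<dots> = (\<integral>\<^sup>+h. (\<Prod>j\<in>insert i K. ennreal (stop_weight (d j) \<beta> (P j) (h j)))
        * (\<integral>\<^sup>+z. G z \<partial>Erl \<beta> (\<Sum>j\<in>insert i K. h j)) \<partial>count_space (PiE (insert i K) (\<lambda>_. UNIV)))"
    by (rule nn_integral_PiE_insert[OF insert.hyps, symmetric])
  finally show ?case .
qed

text \<open>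
  The factor \<open>T\<^sub>l\<close> is handled by size-biasing: it turns shape \<open>h l\<close> into \<open>h l + 1\<close> with the factor
  \<open>h l / \<beta>\<close>, whence the successor in the index of \<^const>\<open>Wbar\<close>. Assignments with \<open>h l = 0\<close> contribute nothing.
\<close>

lemma nn_integral_tail_stop_loss:
  fixes d :: "'i \<Rightarrow> real"
  assumes \<beta>: "0 < \<beta>" and P: "\<And>i. mixing_vector (P i)" and K: "finite K" "l \<notin> K"
    and d: "\<And>i. i \<in> insert l K \<Longrightarrow> 0 \<le> d i" and y: "0 \<le> y"
  shows "(\<integral>\<^sup>+s. ennreal (max 0 (s l - d l)) * indicator {y<..} (\<Sum>i\<in>insert l K. max 0 (s i - d i))
        \<partial>PiM (insert l K) (\<lambda>i. ME \<beta> (P i)))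
    = (\<integral>\<^sup>+h. ennreal ((\<Prod>i\<in>insert l K. stop_weight (d i) \<beta> (P i) (h i)) * (real (h l) / \<beta>)
          * Wbar (Suc (\<Sum>i\<in>insert l K. h i)) y \<beta>)
        \<partial>count_space (PiE (insert l K) (\<lambda>_. UNIV)))"
proof -
  interpret product_sigma_finite "\<lambda>i. ME \<beta> (P i)"
    by (rule product_sigma_finite.intro) (rule prob_space_imp_sigma_finite[OF prob_space_ME[OF \<beta> P]])
  interpret E: prob_space "Erl \<beta> a" for a using \<beta> by (rule prob_space_Erl)
  define c where "c i h = ennreal (stop_weight (d i) \<beta> (P i) h)" for i h
  define G where "G r = (\<Sum>a. c l a * (ennreal (real a / \<beta>) * (\<integral>\<^sup>+t. indicator {y<..} (r + t) \<partial>Erl \<beta> (Suc a))))" for r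
  have [measurable]: "G \<in> borel_measurable borel"
    unfolding G_def[abs_def] by measurable
  have "(\<integral>\<^sup>+s. ennreal (max 0 (s l - d l)) * indicator {y<..} (\<Sum>i\<in>insert l K. max 0 (s i - d i))
        \<partial>PiM (insert l K) (\<lambda>i. ME \<beta> (P i)))
    = (\<integral>\<^sup>+s. (\<integral>\<^sup>+x. ennreal (max 0 ((s(l := x)) l - d l))
        * indicator {y<..} (\<Sum>i\<in>insert l K. max 0 ((s(l := x)) i - d i)) \<partial>ME \<beta> (P l)) \<partial>PiM K (\<lambda>i. ME \<beta> (P i)))"
    using K by (intro product_nn_integral_insert) measurable
  also have "\<dots> = (\<integral>\<^sup>+s. (\<integral>\<^sup>+x. ennreal (max 0 (x - d l))
        * indicator {y<..} ((\<Sum>i\<in>K. max 0 (s i - d i)) + max 0 (x - d l)) \<partial>ME \<beta> (P l)) \<partial>PiM K (\<lambda>i. ME \<beta> (P i)))"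
    using K sum_fun_upd_notin[OF K(2), of "\<lambda>j x. max 0 (x - d j)"]
    by (simp add: add.commute)
  also have "\<dots> = (\<integral>\<^sup>+s. G (\<Sum>i\<in>K. max 0 (s i - d i)) \<partial>PiM K (\<lambda>i. ME \<beta> (P i)))"
    unfolding G_def c_def using d
    by (subst nn_integral_stop_loss[OF \<beta> P, where G="\<lambda>x. ennreal x * indicator {y<..} (r + x)" for r])
       (auto simp: nn_integral_Erl_times[OF \<beta>])
  also have "\<dots> = (\<integral>\<^sup>+h. (\<Prod>i\<in>K. c i (h i)) * (\<integral>\<^sup>+z. G z \<partial>Erl \<beta> (\<Sum>i\<in>K. h i)) \<partial>count_space (PiE K (\<lambda>_. UNIV)))"
    unfolding c_def using K d by (intro nn_integral_sum_stop_loss[OF \<beta> P]) auto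
  also have "\<dots> = (\<integral>\<^sup>+h. (\<Sum>a. (\<Prod>i\<in>insert l K. c i ((h(l := a)) i))
        * (ennreal (real ((h(l := a)) l) / \<beta>) * ennreal (Wbar (Suc (\<Sum>i\<in>insert l K. (h(l := a)) i)) y \<beta>)))
      \<partial>count_space (PiE K (\<lambda>_. UNIV)))"
  proof (rule nn_integral_cong)
    fix h
    have "(\<integral>\<^sup>+z. G z \<partial>Erl \<beta> (\<Sum>i\<in>K. h i))
        = (\<Sum>a. c l a * (ennreal (real a / \<beta>) * ennreal (Wbar (Suc ((\<Sum>i\<in>K. h i) + a)) y \<beta>)))"
      unfolding G_def
      by (simp add: nn_integral_suminf nn_integral_cmult nn_integral_Erl_add[OF \<beta>] Erl_tail[OF \<beta> y]
            del: nn_integral_indicator)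
    then show "(\<Prod>i\<in>K. c i (h i)) * (\<integral>\<^sup>+z. G z \<partial>Erl \<beta> (\<Sum>i\<in>K. h i))
      = (\<Sum>a. (\<Prod>i\<in>insert l K. c i ((h(l := a)) i))
        * (ennreal (real ((h(l := a)) l) / \<beta>) * ennreal (Wbar (Suc (\<Sum>i\<in>insert l K. (h(l := a)) i)) y \<beta>)))"
      using K prod_fun_upd_notin[OF K(2), of c] sum_fun_upd_notin[OF K(2), where f="\<lambda>j x. x" and h="h :: _ \<Rightarrow> nat" for h]
      by (simp only: ennreal_suminf_cmult[symmetric])
         (auto intro!: suminf_cong simp: add.commute mult_ac)
  qed
  also have "\<dots> = (\<integral>\<^sup>+h. (\<Prod>i\<in>insert l K. c i (h i))
        * (ennreal (real (h l) / \<beta>) * ennreal (Wbar (Suc (\<Sum>i\<in>insert l K. h i)) y \<beta>))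
      \<partial>count_space (PiE (insert l K) (\<lambda>_. UNIV)))"
    by (rule nn_integral_PiE_insert[OF K, symmetric])
  also have "\<dots> = (\<integral>\<^sup>+h. ennreal ((\<Prod>i\<in>insert l K. stop_weight (d i) \<beta> (P i) (h i)) * (real (h l) / \<beta>)
          * Wbar (Suc (\<Sum>i\<in>insert l K. h i)) y \<beta>)
        \<partial>count_space (PiE (insert l K) (\<lambda>_. UNIV)))"
  proof (rule nn_integral_cong)
    fix h
    have "0 \<le> Wbar (Suc (\<Sum>i\<in>insert l K. h i)) y \<beta>"
      unfolding Wbar_def using \<beta> y by (intro mult_nonneg_nonneg sum_nonneg) auto
    then show "(\<Prod>i\<in>insert l K. c i (h i)) * (ennreal (real (h l) / \<beta>) * ennreal (Wbar (Suc (\<Sum>i\<in>insert l K. h i)) y \<beta>))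
      = ennreal ((\<Prod>i\<in>insert l K. stop_weight (d i) \<beta> (P i) (h i)) * (real (h l) / \<beta>)
          * Wbar (Suc (\<Sum>i\<in>insert l K. h i)) y \<beta>)"
      unfolding c_def using \<beta> stop_weight_nonneg[OF \<beta> P]
      by (simp add: prod_ennreal prod_nonneg ennreal_mult[symmetric] mult.assoc del: prod.insert sum.insert)
  qed
  finally show ?thesis .
qed

section \<open>The functions U\<close>

lemma has_sum_nn_integral:
  fixes f :: "'a \<Rightarrow> real"
  assumes "\<And>x. x \<in> A \<Longrightarrow> 0 \<le> f x" "(\<integral>\<^sup>+x. ennreal (f x) \<partial>count_space A) = ennreal r" "0 \<le> r"
  shows "(f has_sum r) A"
proof -
  have "has_bochner_integral (count_space A) f r"
    using assms by (intro has_bochner_integral_nn_integral) auto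
  then have abs: "Infinite_Set_Sum.abs_summable_on f A" and r: "infsetsum f A = r"
    by (auto simp: has_bochner_integral_iff Infinite_Set_Sum.abs_summable_on_def infsetsum_def)
  have "f summable_on A"
    using abs abs_summable_equivalent abs_summable_summable by blast
  moreover have "infsum f A = r"
    using infsetsum_infsum[OF abs] r by simp
  ultimately show ?thesis by (simp add: has_sum_iff)
qed

text \<open>
  Split the shape assignments \<open>h\<close> on \<open>I\<close> by their support. Support \<open>insert l J\<close> means that exactly the
  deductibles of \<open>l\<close> and of the portfolios in \<open>J\<close> are exceeded; lowering the shapes by 1 on the support
  turns the weights into \<open>\<Delta>\<close> and \<open>cdf\<close> and the total shape plus 1 into \<open>\<Sum>h + card J + 2\<close>. The resulting
  part of the series is the product of \<^const>\<open>U\<close> with the distribution functions.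
\<close>

lemma tail_stop_loss_eq_U:
  fixes d :: "nat \<Rightarrow> real"
  assumes \<beta>: "0 < \<beta>" and P: "\<And>i. i \<in> I \<Longrightarrow> mixing_vector (P i)" and I: "finite I" and l: "l \<in> I"
    and d: "\<And>i. i \<in> I \<Longrightarrow> 0 \<le> d i" and y: "0 \<le> y" and r: "0 \<le> r"
    and int: "(\<integral>\<^sup>+s. ennreal (max 0 (s l - d l)) * indicator {y<..} (\<Sum>i\<in>I. max 0 (s i - d i))
        \<partial>PiM I (\<lambda>i. ME \<beta> (P i))) = ennreal r"
  shows "(\<Sum>J\<in>Pow (I - {l}). U \<beta> P J l y d * (\<Prod>i\<in>I - insert l J. cdf (ME \<beta> (P i)) (d i))) = r"
proof -
  define \<Phi> where "\<Phi> h = (\<Prod>i\<in>I. stop_weight (d i) \<beta> (P i) (h i)) * (real (h l) / \<beta>)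
    * Wbar (Suc (\<Sum>i\<in>I. h i)) y \<beta>" for h
  define H where "H J = {h \<in> PiE I (\<lambda>_. UNIV :: nat set). {i\<in>I. h i \<noteq> 0} = insert l J}" for J
  \<comment> \<open>Outside \<open>I\<close> the vectors are replaced by that of a single exponential variable, so that all laws
    of the family are probability measures.\<close>
  define P' where "P' i = (if i \<in> I then P i else (\<lambda>k. of_bool (k = 1)))" for i
  have P': "mixing_vector (P' i)" for i
    using P sums_single[of 0 "\<lambda>_. 1 :: real"]
    by (auto simp: P'_def mixing_vector_def of_bool_def if_distrib cong: if_cong)
  have insI: "insert l (I - {l}) = I" using l by auto
  have W0: "0 \<le> Wbar m y \<beta>" for m
    unfolding Wbar_def using \<beta> y by (intro mult_nonneg_nonneg sum_nonneg) auto
  have \<Phi>0: "0 \<le> \<Phi> h" for h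
    unfolding \<Phi>_def using \<beta> stop_weight_nonneg[OF \<beta> P]
    by (intro mult_nonneg_nonneg prod_nonneg W0) auto
  have "PiM I (\<lambda>i. ME \<beta> (P' i)) = PiM I (\<lambda>i. ME \<beta> (P i))"
    by (intro PiM_cong) (auto simp: P'_def)
  then have "(\<integral>\<^sup>+h. ennreal ((\<Prod>i\<in>I. stop_weight (d i) \<beta> (P' i) (h i)) * (real (h l) / \<beta>)
      * Wbar (Suc (\<Sum>i\<in>I. h i)) y \<beta>) \<partial>count_space (PiE I (\<lambda>_. UNIV))) = ennreal r"
    using nn_integral_tail_stop_loss[where P=P' and K="I - {l}" and l=l and d=d and y=y,
        unfolded insI, OF \<beta> P' _ _ d y] I int
    by simp
  moreover have "(\<Prod>i\<in>I. stop_weight (d i) \<beta> (P' i) (h i)) = (\<Prod>i\<in>I. stop_weight (d i) \<beta> (P i) (h i))" for h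
    by (intro prod.cong) (auto simp: P'_def)
  ultimately have "(\<integral>\<^sup>+h. ennreal (\<Phi> h) \<partial>count_space (PiE I (\<lambda>_. UNIV))) = ennreal r"
    by (simp add: \<Phi>_def)
  then have sum_all: "(\<Phi> has_sum r) (PiE I (\<lambda>_. UNIV))"
    by (intro has_sum_nn_integral \<Phi>0 r)
  have sum_H: "(\<Phi> has_sum r) (\<Union>J\<in>Pow (I - {l}). H J)"
  proof (subst has_sum_cong_neutral[where g=\<Phi> and T="PiE I (\<lambda>_. UNIV)"])
    fix h assume "h \<in> PiE I (\<lambda>_. UNIV) - (\<Union>J\<in>Pow (I - {l}). H J)"
    then have h: "h \<in> PiE I (\<lambda>_. UNIV)" and "h \<notin> H ({i\<in>I. h i \<noteq> 0} - {l})" by auto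
    then have "h l = 0" using l by (auto simp: H_def)
    then show "\<Phi> h = 0" by (simp add: \<Phi>_def)
  qed (use sum_all in \<open>auto simp: H_def\<close>)
  have "\<Phi> summable_on H J" if "J \<in> Pow (I - {l})" for J
    using summable_on_subset_banach[OF has_sum_imp_summable[OF sum_H]] that by blast
  then have "(\<Sum>J\<in>Pow (I - {l}). infsum \<Phi> (H J)) = r"
    using infsumI[OF sum_H] I by (subst sum_infsum) (auto simp: H_def)
  moreover have "infsum \<Phi> (H J) = U \<beta> P J l y d * (\<Prod>i\<in>I - insert l J. cdf (ME \<beta> (P i)) (d i))"
    if J: "J \<in> Pow (I - {l})" for J
  proof -
    let ?K = "insert l J"
    have K: "?K \<subseteq> I" "finite ?K" "l \<notin> J" using J l I finite_subset by auto
    \<comment> \<open>\<open>g\<close> maps the assignments over which \<open>U\<close> sums onto those with support \<open>?K\<close>.\<close>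
    define g where "g h = (\<lambda>i\<in>I. if i \<in> ?K then Suc (h i) else 0)" for h :: "nat \<Rightarrow> nat"
    have bij: "bij_betw g (PiE ?K (\<lambda>_. UNIV)) (H J)"
    proof (rule bij_betw_byWitness[where f'="\<lambda>h. \<lambda>i\<in>?K. h i - 1"])
      show "\<forall>h\<in>PiE ?K (\<lambda>_. UNIV). (\<lambda>i\<in>?K. g h i - 1) = h"
        using K(1) by (auto simp: g_def PiE_iff extensional_def fun_eq_iff)
      show "\<forall>h\<in>H J. g (\<lambda>i\<in>?K. h i - 1) = h"
      proof
        fix h assume "h \<in> H J"
        then have h: "h \<in> extensional I" "{i\<in>I. h i \<noteq> 0} = ?K" by (auto simp: H_def PiE_iff)
        show "g (\<lambda>i\<in>?K. h i - 1) = h"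
        proof
          fix i
          show "g (\<lambda>i\<in>?K. h i - 1) i = h i"
            using h(1) K(1) set_eq_iff[THEN iffD1, OF h(2), rule_format, of i]
            by (cases "i \<in> I") (auto simp: g_def extensional_def)
        qed
      qed
      show "g ` PiE ?K (\<lambda>_. UNIV) \<subseteq> H J"
        using K(1) by (auto simp: g_def H_def)
      show "(\<lambda>h. \<lambda>i\<in>?K. h i - 1) ` H J \<subseteq> PiE ?K (\<lambda>_. UNIV)"
        by (rule image_subsetI, simp only: restrict_PiE_iff) blast
    qed
    have \<Phi>g: "\<Phi> (g h) = ((1 / \<beta>) * (\<Prod>i\<in>I - ?K. cdf (ME \<beta> (P i)) (d i))) *
       ((real (h l) + 1) * (\<Prod>i\<in>?K. \<Delta> (h i) (d i) \<beta> (P i)) * Wbar ((\<Sum>i\<in>?K. h i) + card J + 2) y \<beta>)" for h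
    proof -
      have "(\<Prod>i\<in>I. stop_weight (d i) \<beta> (P i) (g h i))
          = (\<Prod>i\<in>I - ?K. stop_weight (d i) \<beta> (P i) (g h i)) * (\<Prod>i\<in>?K. stop_weight (d i) \<beta> (P i) (g h i))"
        by (rule prod.subset_diff[OF K(1) I])
      moreover have "(\<Prod>i\<in>I - ?K. stop_weight (d i) \<beta> (P i) (g h i)) = (\<Prod>i\<in>I - ?K. cdf (ME \<beta> (P i)) (d i))"
        by (rule prod.cong) (auto simp: g_def)
      moreover have "(\<Prod>i\<in>?K. stop_weight (d i) \<beta> (P i) (g h i)) = (\<Prod>i\<in>?K. \<Delta> (h i) (d i) \<beta> (P i))"
        by (rule prod.cong) (use K(1) in \<open>auto simp: g_def\<close>)
      moreover have "g h l = Suc (h l)" using l by (simp add: g_def)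
      moreover have "(\<Sum>i\<in>I. g h i) = (\<Sum>i\<in>?K. Suc (h i))"
        by (rule sum.mono_neutral_cong_right) (use K(1) I in \<open>auto simp: g_def\<close>)
      moreover have "(\<Sum>i\<in>?K. Suc (h i)) = (\<Sum>i\<in>?K. h i) + Suc (card J)"
        using K by (simp only: Suc_eq_plus1 sum.distrib) simp
      ultimately show ?thesis
        by (simp add: \<Phi>_def)
    qed
    have "infsum \<Phi> (H J) = infsum (\<lambda>h. \<Phi> (g h)) (PiE ?K (\<lambda>_. UNIV))"
      by (rule infsum_reindex_bij_betw[OF bij, symmetric])
    also have "\<dots> = U \<beta> P J l y d * (\<Prod>i\<in>I - insert l J. cdf (ME \<beta> (P i)) (d i))"
      unfolding \<Phi>g infsum_cmult_right' U_def by simp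
    finally show ?thesis .
  qed
  ultimately show ?thesis by simp
qed

lemma U_cong:
  assumes "\<And>i k. i \<in> insert l J \<Longrightarrow> 1 \<le> k \<Longrightarrow> P i k = P' i k"
  shows "U \<beta> P J l y d = U \<beta> P' J l y d"
  unfolding U_def
  by (intro arg_cong2[where f="(*)"] infsum_cong refl prod.cong) (auto simp: \<Delta>_def assms)

lemma borel_measurable_component:
  assumes "c \<in> C" "sets (N c) = sets borel"
  shows "(\<lambda>x. x c) \<in> borel_measurable (PiM C N)"
  using measurable_component_singleton[OF assms(1), of N] measurable_cong_sets[OF refl assms(2)] by blast

text \<open>
  The passage from the components to the portfolios: pushed forward to the portfolio sums, a product
  of mixed Erlang laws is the product considered in the preceding results.
\<close>

lemma independent_allocation:
  fixes k :: "nat \<Rightarrow> nat" and d :: "nat \<Rightarrow> real" and q :: "nat \<times> nat \<Rightarrow> nat \<Rightarrow> real" and I :: "nat set"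
  defines "S \<equiv> \<lambda>i x. \<Sum>j=1..k i. x (i, j) :: real"
    and "C \<equiv> SIGMA i:I. {1..k i}"
  assumes \<beta>: "0 < \<beta>" and q: "\<And>c. mixing_vector (q c)" and I: "finite I" and l: "l \<in> I"
    and k: "\<And>i. i \<in> I \<Longrightarrow> 1 \<le> k i"
    and d: "\<And>i. i \<in> I \<Longrightarrow> 0 \<le> d i" and y: "0 \<le> y" and r: "0 \<le> r"
    and int: "(\<integral>\<^sup>+x. ennreal (\<Prod>c\<in>C. ME_pdf \<beta> (q c) (x c)) *
        (ennreal (max 0 (S l x - d l)) * indicator {y<..} (\<Sum>i\<in>I. max 0 (S i x - d i)))
        \<partial>PiM C (\<lambda>_. lborel)) = ennreal r"
  defines "P \<equiv> \<lambda>i. mix_conv (k i) (\<lambda>j. q (i, j))"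
  shows "(\<Sum>J\<in>Pow (I - {l}). U \<beta> P J l y d * (\<Prod>i\<in>I - insert l J. cdf (ME \<beta> (P i)) (d i))) = r"
proof (rule tail_stop_loss_eq_U[OF \<beta> _ I l d y r])
  have C: "finite C" using I by (auto simp: C_def)
  show "mixing_vector (P i)" if "i \<in> I" for i
    unfolding P_def using k[OF that] q by (intro mixing_mix_conv) auto

  define T where "T s = ennreal (max 0 (s l - d l)) * indicator {y<..} (\<Sum>i\<in>I. max 0 (s i - d i))" for s :: "nat \<Rightarrow> real"
  have T [measurable]: "T \<in> borel_measurable (PiM I (\<lambda>_. borel))"
    unfolding T_def[abs_def] using l by measurable
  have S [measurable]: "(\<lambda>x. \<lambda>i\<in>I. S i x) \<in> measurable (PiM C (\<lambda>c. ME \<beta> (q c))) (PiM I (\<lambda>_. borel))"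
    unfolding S_def
    by (intro measurable_restrict borel_measurable_sum borel_measurable_component) (auto simp: C_def)
  have "(\<integral>\<^sup>+s. T s \<partial>PiM I (\<lambda>i. ME \<beta> (P i)))
      = (\<integral>\<^sup>+s. T s \<partial>distr (PiM C (\<lambda>c. ME \<beta> (q c))) (PiM I (\<lambda>_. borel)) (\<lambda>x. \<lambda>i\<in>I. S i x))"
    unfolding P_def S_def C_def using l I by (subst distr_portfolio_sums[OF \<beta> q I _ k]) auto
  also have "\<dots> = (\<integral>\<^sup>+x. T (\<lambda>i\<in>I. S i x) \<partial>PiM C (\<lambda>c. ME \<beta> (q c)))"
    by (intro nn_integral_distr) measurable
  also have "\<dots> = (\<integral>\<^sup>+x. ennreal (\<Prod>c\<in>C. ME_pdf \<beta> (q c) (x c)) * T (\<lambda>i\<in>I. S i x) \<partial>PiM C (\<lambda>_. lborel))"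
  proof -
    have dens: "PiM C (\<lambda>c. ME \<beta> (q c)) = density (PiM C (\<lambda>_. lborel)) (\<lambda>x. ennreal (\<Prod>c\<in>C. ME_pdf \<beta> (q c) (x c)))"
      by (rule PiM_ME[OF C \<beta> q])
    have "(\<lambda>x. T (\<lambda>i\<in>I. S i x)) \<in> borel_measurable (PiM C (\<lambda>c. ME \<beta> (q c)))" by measurable
    then show ?thesis
      unfolding dens by (intro nn_integral_density) auto
  qed
  also have "\<dots> = ennreal r"
    unfolding int[symmetric] T_def using l by (intro nn_integral_cong) simp
  finally show "(\<integral>\<^sup>+s. ennreal (max 0 (s l - d l)) * indicator {y<..} (\<Sum>i\<in>I. max 0 (s i - d i))
        \<partial>PiM I (\<lambda>i. ME \<beta> (P i))) = ennreal r"
    by (simp add: T_def)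
qed auto

section \<open>The value at risk\<close>

text \<open>
  The minimum in the definition of the value at risk is attained, since a distribution function is
  continuous from the right and tends to 1; and no negative number qualifies.
\<close>

lemma VaR_nonneg:
  assumes M: "prob_space M" and Z [measurable]: "Z \<in> borel_measurable M" and nonneg: "AE \<omega> in M. 0 \<le> Z \<omega>"
    and p: "0 < p" "p < 1"
  shows "0 \<le> VaR M p Z"
proof -
  interpret M: prob_space M by fact
  interpret D: real_distribution "distr M borel Z" by (rule M.real_distribution_distr) simp
  let ?F = "cdf (distr M borel Z)"
  define A where "A = {x. p \<le> ?F x}"
  have neg: "?F x = 0" if "x < 0" for x
  proof -
    have "AE \<omega> in M. \<not> Z \<omega> \<le> x" using nonneg by eventually_elim (use that in auto)
    then have "M.prob {\<omega>\<in>space M. Z \<omega> \<le> x} = 0"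
      by (subst M.prob_eq_0) auto
    then show ?thesis
      by (simp add: cdf_def measure_distr vimage_def Int_def conj_commute)
  qed
  have A0: "0 \<le> x" if "x \<in> A" for x
    using neg[of x] that p by (force simp: A_def)
  have "eventually (\<lambda>x. p < ?F x) at_top"
    by (rule order_tendstoD(1)[OF D.cdf_lim_at_top_prob p(2)])
  then obtain x where "p < ?F x" by (auto simp: eventually_at_top_linorder)
  then have ne: "A \<noteq> {}" by (auto simp: A_def intro: less_imp_le)
  have bdd: "bdd_below A" by (rule bdd_belowI[OF A0])
  have above: "p \<le> ?F x" if "Inf A < x" for x
  proof -
    obtain a where "a \<in> A" "a < x" using cInf_lessD[OF ne \<open>Inf A < x\<close>] by auto
    then show ?thesis using D.cdf_nondecreasing[of a x] by (auto simp: A_def)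
  qed
  have "p \<le> ?F (Inf A)"
  proof (rule tendsto_lowerbound)
    show "(?F \<longlongrightarrow> ?F (Inf A)) (at_right (Inf A))"
      using D.cdf_is_right_cont by (simp add: continuous_within)
    show "eventually (\<lambda>x. p \<le> ?F x) (at_right (Inf A))"
      using above by (auto simp: eventually_at_filter)
  qed simp
  then have "VaR M p Z = Inf A"
    unfolding VaR_def by (intro Least_equality cInf_lower bdd) (auto simp: A_def)
  then show ?thesis using cInf_greatest[OF ne A0] by simp
qed

section \<open>Expansion of the Sarmanov density\<close>

text \<open>
  The unordered pairs of distinct components, each listed once in the order in which the coefficients
  \<open>\<alpha>\<close> are indexed. The set merges the sums over pairs within one portfolio and across two portfolios.
\<close>

definition index_pairs :: "nat \<Rightarrow> (nat \<Rightarrow> nat) \<Rightarrow> (nat \<times> nat \<times> nat \<times> nat) set" where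
  "index_pairs n k = (SIGMA a:{1..n}. SIGMA b:{a..n}. SIGMA s:{1..k a}. {Tidx s a b..k b})"

lemma finite_index_pairs [simp]: "finite (index_pairs n k)"
  unfolding index_pairs_def by auto

lemma sum_index_pairs:
  "(\<Sum>a=1..n. \<Sum>b=a..n. \<Sum>s=1..k a. \<Sum>t=Tidx s a b..k b. g a b s t)
    = (\<Sum>(a, b, s, t)\<in>index_pairs n k. g a b s t)"
  unfolding index_pairs_def by (simp add: sum.Sigma)

lemma Tidx_simps [simp]: "Tidx s a a = s + 1" "a \<noteq> b \<Longrightarrow> Tidx s a b = 1"
  by (auto simp: Tidx_def)

lemma index_pairsD:
  assumes "(a, b, s, t) \<in> index_pairs n k"
  shows "(a, s) \<in> components n k" "(b, t) \<in> components n k" "(a, s) \<noteq> (b, t)"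
  using assms by (auto simp: index_pairs_def components_def Tidx_def split: if_splits)

lemma sarmanov_bracket_index_pairs:
  "sarmanov_bracket n k \<beta> Q \<alpha> x = 1 + (\<Sum>(a, b, s, t)\<in>index_pairs n k.
    \<alpha> a b s t * \<phi> \<beta> Q a s (x (a, s)) * \<phi> \<beta> Q b t (x (b, t)))"
proof -
  let ?g = "\<lambda>a b s t. \<alpha> a b s t * \<phi> \<beta> Q a s (x (a, s)) * \<phi> \<beta> Q b t (x (b, t))"
  have "(\<Sum>b=a..n. \<Sum>s=1..k a. \<Sum>t=Tidx s a b..k b. ?g a b s t)
      = (\<Sum>b=a+1..n. \<Sum>s=1..k a. \<Sum>t=1..k b. ?g a b s t) + (\<Sum>s=1..k a. \<Sum>t=s+1..k a. ?g a a s t)"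
    if "a \<in> {1..n}" for a
    using that by (subst sum.atLeast_Suc_atMost) (auto intro!: sum.cong)
  then show ?thesis
    unfolding sarmanov_bracket_def sum_index_pairs[symmetric] by (simp add: sum.distrib)
qed

lemma \<xi>_index_pairs:
  "\<xi> n k \<beta> Q \<alpha> = 1 + (\<Sum>(a, b, s, t)\<in>index_pairs n k. \<alpha> a b s t * \<gamma> \<beta> Q a s * \<gamma> \<beta> Q b t)"
  unfolding \<xi>_def sum_index_pairs ..

text \<open>
  For a set \<open>A\<close> of components this is the product of the marginal densities, with \<open>f\<^sup>2/\<gamma>\<close> in the place of
  \<open>f\<close> for the components in \<open>A\<close>. Keeping the product of all \<open>f\<close> as a common factor makes the expansion
  of the Sarmanov density a matter of algebra.
\<close>

definition squared_pdf :: "nat \<Rightarrow> (nat \<Rightarrow> nat) \<Rightarrow> (nat \<Rightarrow> nat \<Rightarrow> real) \<Rightarrow> (nat \<Rightarrow> nat \<Rightarrow> nat \<Rightarrow> real)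
    \<Rightarrow> (nat \<times> nat) set \<Rightarrow> (nat \<times> nat \<Rightarrow> real) \<Rightarrow> real" where
  "squared_pdf n k \<beta> Q A x = (\<Prod>(i, j)\<in>components n k. ME_pdf (\<beta> i j) (Q i j) (x (i, j)))
    * (\<Prod>(i, j)\<in>A. ME_pdf (\<beta> i j) (Q i j) (x (i, j)) / \<gamma> \<beta> Q i j)"

lemma finite_components [simp]: "finite (components n k)"
  by (simp add: components_def)

lemma sarmanov_pdf_eq_squared_pdf:
  assumes \<gamma>: "\<And>i j. (i, j) \<in> components n k \<Longrightarrow> \<gamma> \<beta> Q i j \<noteq> 0"
  shows "sarmanov_pdf n k \<beta> Q \<alpha> x = \<xi> n k \<beta> Q \<alpha> * squared_pdf n k \<beta> Q {} x
    - (\<Sum>(a, b, s, t)\<in>index_pairs n k. \<alpha> a b s t * \<gamma> \<beta> Q a s * \<gamma> \<beta> Q b t *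
        (squared_pdf n k \<beta> Q {(a, s)} x + squared_pdf n k \<beta> Q {(b, t)} x
          - squared_pdf n k \<beta> Q {(a, s), (b, t)} x))"
proof -
  let ?f = "\<lambda>i j. ME_pdf (\<beta> i j) (Q i j) (x (i, j))"
  let ?g = "\<gamma> \<beta> Q"
  define F where "F = (\<Prod>(i, j)\<in>components n k. ?f i j)"
  have F: "(\<Prod>i=1..n. \<Prod>j=1..k i. ?f i j) = F"
    unfolding F_def components_def by (simp add: prod.Sigma)
  have "F * (\<alpha> a b s t * \<phi> \<beta> Q a s (x (a, s)) * \<phi> \<beta> Q b t (x (b, t)))
      = \<alpha> a b s t * ?g a s * ?g b t * F
        - \<alpha> a b s t * ?g a s * ?g b t * (squared_pdf n k \<beta> Q {(a, s)} x + squared_pdf n k \<beta> Q {(b, t)} x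
          - squared_pdf n k \<beta> Q {(a, s), (b, t)} x)"
    if "(a, b, s, t) \<in> index_pairs n k" for a b s t
  proof -
    note * = index_pairsD[OF that]
    have g: "?g a s \<noteq> 0" "?g b t \<noteq> 0" using \<gamma> * by auto
    have sq: "squared_pdf n k \<beta> Q {(a, s)} x = F * (?f a s / ?g a s)"
      "squared_pdf n k \<beta> Q {(b, t)} x = F * (?f b t / ?g b t)"
      "squared_pdf n k \<beta> Q {(a, s), (b, t)} x = F * (?f a s / ?g a s * (?f b t / ?g b t))"
      using *(3) by (simp_all add: squared_pdf_def F_def[symmetric])
    show ?thesis
      unfolding sq \<phi>_def using g by (simp add: field_simps)
  qed
  then have "(\<Sum>(a, b, s, t)\<in>index_pairs n k. F * (\<alpha> a b s t * \<phi> \<beta> Q a s (x (a, s)) * \<phi> \<beta> Q b t (x (b, t))))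
      = (\<Sum>(a, b, s, t)\<in>index_pairs n k. \<alpha> a b s t * ?g a s * ?g b t * F
        - \<alpha> a b s t * ?g a s * ?g b t * (squared_pdf n k \<beta> Q {(a, s)} x + squared_pdf n k \<beta> Q {(b, t)} x
          - squared_pdf n k \<beta> Q {(a, s), (b, t)} x))"
    by (intro sum.cong refl) auto
  moreover have "squared_pdf n k \<beta> Q {} x = F"
    by (simp add: squared_pdf_def F_def)
  ultimately show ?thesis
    unfolding sarmanov_pdf_def F sarmanov_bracket_index_pairs \<xi>_index_pairs
    by (simp add: ring_distribs sum_distrib_left sum_distrib_right sum_subtractf case_prod_unfold)
qed

section \<open>Mixing vectors of the squared densities\<close>

text \<open>
  The mixing vectors, at the common scale, of the factors of \<^const>\<open>squared_pdf\<close>. Outside the model the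
  value is the vector of a single exponential variable, so that it is a mixing vector everywhere.
\<close>

definition square_mixing :: "nat \<Rightarrow> (nat \<Rightarrow> nat) \<Rightarrow> (nat \<Rightarrow> nat \<Rightarrow> real) \<Rightarrow> (nat \<Rightarrow> nat \<Rightarrow> nat \<Rightarrow> real)
    \<Rightarrow> (nat \<times> nat) set \<Rightarrow> nat \<times> nat \<Rightarrow> nat \<Rightarrow> real" where
  "square_mixing n k \<beta> Q A = (\<lambda>(i, j).
     if (i, j) \<notin> components n k then (\<lambda>m. of_bool (m = 1))
     else if (i, j) \<in> A then \<Psi> (2 * \<beta> i j) (2 * \<beta> n (k n)) (V (Q i j))
     else \<Psi> (\<beta> i j) (2 * \<beta> n (k n)) (Q i j))"

locale sarmanov_marginals =
  fixes n :: nat and k :: "nat \<Rightarrow> nat" and \<beta> :: "nat \<Rightarrow> nat \<Rightarrow> real" and Q :: "nat \<Rightarrow> nat \<Rightarrow> nat \<Rightarrow> real"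
  assumes n: "1 \<le> n" and k: "\<And>i. i \<in> {1..n} \<Longrightarrow> 1 \<le> k i"
    and scale: "\<And>i j. (i, j) \<in> components n k \<Longrightarrow> 0 < \<beta> i j"
    and scale_le: "\<And>i j. (i, j) \<in> components n k \<Longrightarrow> \<beta> i j \<le> \<beta> n (k n)"
    and mixing: "\<And>i j. (i, j) \<in> components n k \<Longrightarrow> mixing_vector (Q i j)"
begin

abbreviation "B \<equiv> 2 * \<beta> n (k n)"
abbreviation "pdf i j \<equiv> ME_pdf (\<beta> i j) (Q i j)"

lemma last_component: "(n, k n) \<in> components n k"
  using n k[of n] by (simp add: components_def)

lemma B_pos: "0 < B"
  using scale[OF last_component] by simp

lemma \<gamma>_pos: "(i, j) \<in> components n k \<Longrightarrow> 0 < \<gamma> \<beta> Q i j"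
  using ME_square(1)[OF scale mixing] by (simp add: \<gamma>_def)

lemma square_mixing:
  shows mixing_square_mixing: "mixing_vector (square_mixing n k \<beta> Q A c)"
    and ME_pdf_square_mixing: "(i, j) \<in> components n k \<Longrightarrow>
      ME_pdf B (square_mixing n k \<beta> Q A (i, j)) x = pdf i j x * (if (i, j) \<in> A then pdf i j x / \<gamma> \<beta> Q i j else 1)"
proof -
  have unit: "mixing_vector (\<lambda>m. of_bool (m = 1))"
    using sums_single[of 0 "\<lambda>_. 1 :: real"] by (auto simp: mixing_vector_def of_bool_def)
  have *: "mixing_vector (square_mixing n k \<beta> Q A (i, j)) \<and>
      ME_pdf B (square_mixing n k \<beta> Q A (i, j)) x = pdf i j x * (if (i, j) \<in> A then pdf i j x / \<gamma> \<beta> Q i j else 1)"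
    if c: "(i, j) \<in> components n k" for i j x
  proof (cases "(i, j) \<in> A")
    case True
    have "0 < 2 * \<beta> i j" "2 * \<beta> i j \<le> B" using scale[OF c] scale_le[OF c] by auto
    with True c show ?thesis
      using ME_change_scale[of "2 * \<beta> i j" B "V (Q i j)"] ME_square(2,3)[OF scale[OF c] mixing[OF c]]
      by (simp add: square_mixing_def \<gamma>_def power2_eq_square)
  next
    case False
    have "\<beta> i j \<le> B" using scale[OF c] scale_le[OF c] by auto
    with False c show ?thesis
      using ME_change_scale[OF scale[OF c] _ mixing[OF c]] by (simp add: square_mixing_def)
  qed
  show "mixing_vector (square_mixing n k \<beta> Q A c)"
    using * unit by (cases c; cases "c \<in> components n k") (auto simp: square_mixing_def[of n k \<beta> Q A])
  show "(i, j) \<in> components n k \<Longrightarrow>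
      ME_pdf B (square_mixing n k \<beta> Q A (i, j)) x = pdf i j x * (if (i, j) \<in> A then pdf i j x / \<gamma> \<beta> Q i j else 1)"
    using * by blast
qed

lemma squared_pdf_eq_prod:
  assumes "A \<subseteq> components n k"
  shows "squared_pdf n k \<beta> Q A x = (\<Prod>c\<in>components n k. ME_pdf B (square_mixing n k \<beta> Q A c) (x c))"
proof -
  have "(\<Prod>c\<in>components n k. ME_pdf B (square_mixing n k \<beta> Q A c) (x c))
    = (\<Prod>(i, j)\<in>components n k. pdf i j (x (i, j)) * (if (i, j) \<in> A then pdf i j (x (i, j)) / \<gamma> \<beta> Q i j else 1))"
    by (intro prod.cong refl) (auto simp: ME_pdf_square_mixing)
  also have "\<dots> = (\<Prod>(i, j)\<in>components n k. pdf i j (x (i, j)))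
      * (\<Prod>c\<in>components n k. if c \<in> A then (case c of (i, j) \<Rightarrow> pdf i j (x (i, j)) / \<gamma> \<beta> Q i j) else 1)"
    unfolding prod.distrib[symmetric] by (intro prod.cong) auto
  also have "\<dots> = squared_pdf n k \<beta> Q A x"
    unfolding squared_pdf_def
    using assms by (subst prod.inter_restrict[symmetric]) (auto simp: Int_absorb1)
  finally show ?thesis ..
qed

lemma squared_pdf_nonneg: "A \<subseteq> components n k \<Longrightarrow> 0 \<le> squared_pdf n k \<beta> Q A x"
  unfolding squared_pdf_eq_prod
  by (intro prod_nonneg) (auto intro!: ME_pdf_nonneg B_pos mixing_square_mixing simp del: mult_pos_pos)

text \<open>
  A mixed Erlang density is bounded by its scale, so replacing \<open>f\<close> by \<open>f\<^sup>2/\<gamma>\<close> increases the product of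
  densities by a constant factor at most. This transfers integrability from \<open>A = {}\<close> to every \<open>A\<close>.
\<close>

lemma squared_pdf_le:
  assumes A: "A \<subseteq> components n k"
  shows "squared_pdf n k \<beta> Q A x \<le> (\<Prod>(i, j)\<in>A. \<beta> i j / \<gamma> \<beta> Q i j) * squared_pdf n k \<beta> Q {} x"
proof -
  have le: "(\<Prod>(i, j)\<in>A. pdf i j (x (i, j)) / \<gamma> \<beta> Q i j) \<le> (\<Prod>(i, j)\<in>A. \<beta> i j / \<gamma> \<beta> Q i j)"
  proof (rule prod_mono, clarify)
    fix i j assume "(i, j) \<in> A"
    then have c: "(i, j) \<in> components n k" using A by auto
    show "0 \<le> pdf i j (x (i, j)) / \<gamma> \<beta> Q i j \<and> pdf i j (x (i, j)) / \<gamma> \<beta> Q i j \<le> \<beta> i j / \<gamma> \<beta> Q i j"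
      using \<gamma>_pos[OF c] ME_pdf_nonneg[OF scale[OF c] mixing[OF c]] ME_pdf_le[OF scale[OF c] mixing[OF c]]
      by (simp add: divide_right_mono)
  qed
  show ?thesis
    using mult_left_mono[OF le squared_pdf_nonneg[of "{}" x]] by (simp add: squared_pdf_def mult.commute)
qed

lemma mixS_eq_mix_conv:
  assumes "i \<in> {1..n}"
  shows "mixS n k \<beta> Q A i m = mix_conv (k i) (\<lambda>j. square_mixing n k \<beta> Q A (i, j)) m"
  unfolding mixS_def
  by (rule mix_conv_cong) (use assms in \<open>auto simp: square_mixing_def components_def\<close>)

lemma borel_measurable_squared_pdf:
  assumes "A \<subseteq> components n k"
  shows "squared_pdf n k \<beta> Q A \<in> borel_measurable (PiM (components n k) (\<lambda>_. lborel))"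
proof -
  have "squared_pdf n k \<beta> Q A = (\<lambda>x. \<Prod>c\<in>components n k. ME_pdf B (square_mixing n k \<beta> Q A c) (x c))"
    by (rule ext) (rule squared_pdf_eq_prod[OF assms])
  then show ?thesis
    by (simp only:)
       (intro borel_measurable_prod measurable_compose[OF borel_measurable_component ME_pdf_measurable], auto)
qed

end

section \<open>The allocation formula\<close>

context sarmanov_marginals
begin

definition portfolio :: "nat \<Rightarrow> (nat \<times> nat \<Rightarrow> real) \<Rightarrow> real" where
  "portfolio i x = (\<Sum>j=1..k i. x (i, j))"

definition tail_loss :: "(nat \<Rightarrow> real) \<Rightarrow> nat \<Rightarrow> real \<Rightarrow> (nat \<times> nat \<Rightarrow> real) \<Rightarrow> real" where
  "tail_loss d l y x = max 0 (portfolio l x - d l) * of_bool (y < (\<Sum>i=1..n. max 0 (portfolio i x - d i)))"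

lemma borel_measurable_portfolio:
  assumes "i \<in> {1..n}"
  shows "portfolio i \<in> borel_measurable (PiM (components n k) (\<lambda>_. lborel))"
  unfolding portfolio_def[abs_def]
  by (intro borel_measurable_sum borel_measurable_component) (use assms in \<open>auto simp: components_def\<close>)

lemma borel_measurable_tail_loss:
  assumes "l \<in> {1..n}"
  shows "tail_loss d l y \<in> borel_measurable (PiM (components n k) (\<lambda>_. lborel))"
proof -
  note [measurable] = borel_measurable_portfolio borel_measurable_portfolio[OF assms]
  show ?thesis unfolding tail_loss_def[abs_def] by measurable
qed

lemma tail_loss_nonneg: "0 \<le> tail_loss d l y x"
  by (simp add: tail_loss_def)

lemma tail_loss_le:
  assumes "0 \<le> d l"
  shows "tail_loss d l y x \<le> (\<Sum>j=1..k l. max 0 (x (l, j)))"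
proof -
  have "portfolio l x \<le> (\<Sum>j=1..k l. max 0 (x (l, j)))"
    unfolding portfolio_def by (rule sum_mono) simp
  moreover have "0 \<le> (\<Sum>j=1..k l. max 0 (x (l, j)))"
    by (rule sum_nonneg) simp
  ultimately show ?thesis
    using assms by (auto simp: tail_loss_def)
qed

lemma nn_integral_component_squared_pdf:
  assumes c: "(i, j) \<in> components n k"
  shows "(\<integral>\<^sup>+x. ennreal (squared_pdf n k \<beta> Q {} x) * ennreal (x (i, j)) \<partial>PiM (components n k) (\<lambda>_. lborel))
    = (\<integral>\<^sup>+t. ennreal (pdf i j t) * ennreal t \<partial>lborel)"
proof -
  let ?m = "square_mixing n k \<beta> Q {}"
  let ?P = "PiM (components n k) (\<lambda>c. ME B (?m c))"
  have P: "?P = density (PiM (components n k) (\<lambda>_. lborel)) (\<lambda>x. ennreal (squared_pdf n k \<beta> Q {} x))"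
    by (simp add: PiM_ME B_pos[simplified] mixing_square_mixing squared_pdf_eq_prod)
  have [measurable]: "(\<lambda>x. x (i, j)) \<in> borel_measurable (PiM (components n k) (\<lambda>_. lborel))"
    by (rule borel_measurable_component[OF c]) simp
  note [measurable] = borel_measurable_squared_pdf[of "{}", simplified]
  have T: "(\<lambda>x. x (i, j)) \<in> measurable ?P (ME B (?m (i, j)))"
    by (rule measurable_component_singleton[OF c])
  have "(\<integral>\<^sup>+x. ennreal (squared_pdf n k \<beta> Q {} x) * ennreal (x (i, j)) \<partial>PiM (components n k) (\<lambda>_. lborel))
      = (\<integral>\<^sup>+x. ennreal (x (i, j)) \<partial>?P)"
    unfolding P by (subst nn_integral_density) auto
  also have "\<dots> = (\<integral>\<^sup>+t. ennreal t \<partial>distr ?P (ME B (?m (i, j))) (\<lambda>x. x (i, j)))"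
    by (rule nn_integral_distr[OF T, symmetric]) (simp cong: measurable_cong_sets)
  also have "\<dots> = (\<integral>\<^sup>+t. ennreal t \<partial>ME B (?m (i, j)))"
    by (subst distr_PiM_component) (auto intro!: prob_space_ME mixing_square_mixing B_pos c)
  also have "\<dots> = (\<integral>\<^sup>+t. ennreal (pdf i j t) * ennreal t \<partial>lborel)"
    unfolding ME_def by (subst nn_integral_density) (auto simp: ME_pdf_square_mixing[OF c])
  finally show ?thesis .
qed

text \<open>
  Finite means of the components of portfolio \<open>l\<close> make the integral finite for \<open>A = {}\<close>, hence for
  all \<open>A\<close>, and a finite integral is what the result on independent components asks for.
\<close>

lemma squared_pdf_allocation:
  assumes A: "A \<subseteq> components n k" and l: "l \<in> {1..n}" and y: "0 \<le> y"
    and d: "\<And>i. i \<in> {1..n} \<Longrightarrow> 0 \<le> d i"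
    and mean: "\<And>j. j \<in> {1..k l} \<Longrightarrow> (\<integral>\<^sup>+t. ennreal (pdf l j t) * ennreal t \<partial>lborel) < \<infinity>"
  shows "integrable (PiM (components n k) (\<lambda>_. lborel)) (\<lambda>x. squared_pdf n k \<beta> Q A x * tail_loss d l y x)"
    (is "integrable ?L ?h")
    and "(LINT x|PiM (components n k) (\<lambda>_. lborel). squared_pdf n k \<beta> Q A x * tail_loss d l y x)
      = (\<Sum>J\<in>Pow ({1..n} - {l}). U B (mixS n k \<beta> Q A) J l y d
          * (\<Prod>i\<in>{1..n} - insert l J. cdf (ME B (mixS n k \<beta> Q A i)) (d i)))"
proof -
  note [measurable] = borel_measurable_squared_pdf[OF A] borel_measurable_squared_pdf[of "{}", simplified]
    borel_measurable_tail_loss[OF l]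
  have comp: "(l, j) \<in> components n k" if "j \<in> {1..k l}" for j
    using that l by (simp add: components_def)
  have comp_meas: "(\<lambda>x. x (l, j)) \<in> borel_measurable ?L" if "j \<in> {1..k l}" for j
    by (rule borel_measurable_component[OF comp[OF that]]) simp
  define K where "K = (\<Prod>(i, j)\<in>A. \<beta> i j / \<gamma> \<beta> Q i j)"
  have K: "0 \<le> K"
    unfolding K_def using A \<gamma>_pos scale by (intro prod_nonneg) (auto intro!: divide_nonneg_pos less_imp_le)
  have h0: "0 \<le> ?h x" for x
    by (simp add: squared_pdf_nonneg[OF A] tail_loss_nonneg)
  have "(\<integral>\<^sup>+x. ennreal (?h x) \<partial>?L)
      \<le> (\<integral>\<^sup>+x. ennreal K * (\<Sum>j=1..k l. ennreal (squared_pdf n k \<beta> Q {} x) * ennreal (x (l, j))) \<partial>?L)"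
  proof (rule nn_integral_mono)
    fix x
    have "?h x \<le> (K * squared_pdf n k \<beta> Q {} x) * (\<Sum>j=1..k l. max 0 (x (l, j)))"
      using squared_pdf_le[OF A] tail_loss_le[where d=d and l=l and x=x and y=y, OF d[OF l]] K
      by (intro mult_mono) (auto simp: K_def tail_loss_nonneg squared_pdf_nonneg intro!: mult_nonneg_nonneg)
    then have "ennreal (?h x) \<le> ennreal ((K * squared_pdf n k \<beta> Q {} x) * (\<Sum>j=1..k l. max 0 (x (l, j))))"
      by (rule ennreal_leI)
    also have "\<dots> = ennreal K * (\<Sum>j=1..k l. ennreal (squared_pdf n k \<beta> Q {} x) * ennreal (x (l, j)))"
      using K squared_pdf_nonneg[of "{}" x]
      by (simp add: ennreal_mult sum_nonneg sum_distrib_left mult.assoc ennreal_max_0 flip: sum_ennreal)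
    finally show "ennreal (?h x)
      \<le> ennreal K * (\<Sum>j=1..k l. ennreal (squared_pdf n k \<beta> Q {} x) * ennreal (x (l, j)))" .
  qed
  also have "\<dots> = ennreal K * (\<Sum>j=1..k l. \<integral>\<^sup>+t. ennreal (pdf l j t) * ennreal t \<partial>lborel)"
    using comp_meas
    by (simp add: nn_integral_cmult nn_integral_sum nn_integral_component_squared_pdf[OF comp]
          del: atLeastAtMost_iff)
  also have "\<dots> < \<infinity>"
    using mean by (simp add: ennreal_mult_less_top ennreal_sum_less_top)
  finally show int: "integrable ?L ?h"
    using h0 by (intro integrableI_nonneg) auto
  have P: "mixS n k \<beta> Q A i = mix_conv (k i) (\<lambda>j. square_mixing n k \<beta> Q A (i, j))" if "i \<in> {1..n}" for i
    using mixS_eq_mix_conv[OF that] by (rule ext)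
  have "(\<integral>\<^sup>+x. ennreal (\<Prod>c\<in>components n k. ME_pdf B (square_mixing n k \<beta> Q A c) (x c)) *
      (ennreal (max 0 (portfolio l x - d l)) * indicator {y<..} (\<Sum>i=1..n. max 0 (portfolio i x - d i))) \<partial>?L)
    = (\<integral>\<^sup>+x. ennreal (?h x) \<partial>?L)"
    unfolding squared_pdf_eq_prod[OF A, symmetric] tail_loss_def
    by (intro nn_integral_cong) (auto simp: ennreal_mult squared_pdf_nonneg[OF A] split: split_indicator)
  also have "\<dots> = ennreal (LINT x|?L. ?h x)"
    using int h0 by (intro nn_integral_eq_integral) auto
  finally have "(\<Sum>J\<in>Pow ({1..n} - {l}). U B (\<lambda>i. mix_conv (k i) (\<lambda>j. square_mixing n k \<beta> Q A (i, j))) J l y d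
      * (\<Prod>i\<in>{1..n} - insert l J. cdf (ME B (mix_conv (k i) (\<lambda>j. square_mixing n k \<beta> Q A (i, j)))) (d i)))
    = (LINT x|?L. ?h x)"
    using h0 unfolding portfolio_def components_def
    by (intro independent_allocation[OF B_pos mixing_square_mixing _ l k d y]) (auto intro!: integral_nonneg)
  moreover have "U B (\<lambda>i. mix_conv (k i) (\<lambda>j. square_mixing n k \<beta> Q A (i, j))) J l y d = U B (mixS n k \<beta> Q A) J l y d"
    if "J \<in> Pow ({1..n} - {l})" for J
    using that l by (intro U_cong) (auto simp: P)
  ultimately show "(LINT x|?L. ?h x) = (\<Sum>J\<in>Pow ({1..n} - {l}). U B (mixS n k \<beta> Q A) J l y d
          * (\<Prod>i\<in>{1..n} - insert l J. cdf (ME B (mixS n k \<beta> Q A i)) (d i)))"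
    by (simp add: P)
qed

end

lemma sum_Pow_card:
  assumes "finite S" "card S \<le> m"
  shows "(\<Sum>c=0..m. \<Sum>J | J \<subseteq> S \<and> card J = c. f J) = (\<Sum>J\<in>Pow S. f J)"
proof -
  have "{J. J \<subseteq> S \<and> card J = c} = {J \<in> Pow S. card J = c}" for c by auto
  moreover have "card ` Pow S \<subseteq> {0..m}"
    using assms by (auto intro: order_trans[OF card_mono])
  ultimately show ?thesis
    using sum.group[of "Pow S" "{0..m}" card f] assms by simp
qed

theorem proposition3p5:
  fixes M :: "'a measure"
    and n l :: nat
    and k :: "nat \<Rightarrow> nat"
    and \<beta> :: "nat \<Rightarrow> nat \<Rightarrow> real"
    and Q :: "nat \<Rightarrow> nat \<Rightarrow> nat \<Rightarrow> real"
    and \<alpha> :: "nat \<Rightarrow> nat \<Rightarrow> nat \<Rightarrow> nat \<Rightarrow> real"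
    and X :: "nat \<Rightarrow> nat \<Rightarrow> 'a \<Rightarrow> real"
    and d :: "nat \<Rightarrow> real"
    and p B x\<^sub>p :: real
  assumes model: "SME M n k \<beta> Q \<alpha> X"
    and gamma_finite: "\<And>i j. i \<in> {1..n} \<Longrightarrow> j \<in> {1..k i} \<Longrightarrow>
          (\<integral>\<^sup>+x. ennreal (ME_pdf (\<beta> i j) (Q i j) x) \<partial>ME (\<beta> i j) (Q i j)) < \<infinity>"
    and scale_le: "\<And>i j. i \<in> {1..n} \<Longrightarrow> j \<in> {1..k i} \<Longrightarrow> \<beta> i j \<le> \<beta> n (k n)"
    and d_pos: "\<And>i. i \<in> {1..n} \<Longrightarrow> d i > 0"
    and p: "0 < p" "p < 1"
    and l: "l \<in> {1..n}"
    and expectation_exists: "integrable M (tail_part M p (stop_loss k X d l) (total_loss n k X d))"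
    and x\<^sub>p: "x\<^sub>p = VaR M p (total_loss n k X d)"
    and B: "B = 2 * \<beta> n (k n)"
  shows "TVaR_alloc M p (stop_loss k X d l) (total_loss n k X d) =
    1 / (1 - p) * (\<Sum>m=0..n-1. \<Sum>J | J \<subseteq> {1..n} - {l} \<and> card J = m.
      (\<xi> n k \<beta> Q \<alpha> * U B (mixS1 n k \<beta> Q) J l x\<^sub>p d
         * (\<Prod>i\<in>{1..n} - insert l J. cdf (ME B (mixS1 n k \<beta> Q i)) (d i))
       - (\<Sum>a=1..n. \<Sum>b=a..n. \<Sum>s=1..k a. \<Sum>t=Tidx s a b..k b.
           \<alpha> a b s t * \<gamma> \<beta> Q a s * \<gamma> \<beta> Q b t *
           (U B (mixS2 n k \<beta> Q a s) J l x\<^sub>p d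
              * (\<Prod>i\<in>{1..n} - insert l J. cdf (ME B (mixS2 n k \<beta> Q a s i)) (d i))
          + U B (mixS2 n k \<beta> Q b t) J l x\<^sub>p d
              * (\<Prod>i\<in>{1..n} - insert l J. cdf (ME B (mixS2 n k \<beta> Q b t i)) (d i))
          - U B (mixS3 n k \<beta> Q a b s t) J l x\<^sub>p d
              * (\<Prod>i\<in>{1..n} - insert l J. cdf (ME B (mixS3 n k \<beta> Q a b s t i)) (d i))))))"
proof -
  let ?C = "components n k"
  let ?L = "PiM ?C (\<lambda>_. lborel) :: (nat \<times> nat \<Rightarrow> real) measure"
  let ?T = "stop_loss k X d" and ?R = "total_loss n k X d"
  define Z where "Z \<omega> = (\<lambda>c\<in>?C. X (fst c) (snd c) \<omega>)" for \<omega>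
  have M: "prob_space M" and n: "1 \<le> n" and k: "\<And>i. i \<in> {1..n} \<Longrightarrow> 1 \<le> k i"
    and comp: "\<And>i j. (i, j) \<in> ?C \<Longrightarrow> 0 < \<beta> i j \<and> mixing_vector (Q i j) \<and>
      distributed M lborel (X i j) (\<lambda>x. ennreal (ME_pdf (\<beta> i j) (Q i j) x))"
    and bracket: "\<And>x. (\<forall>c\<in>?C. 0 \<le> x c) \<Longrightarrow> 0 \<le> sarmanov_bracket n k \<beta> Q \<alpha> x"
    and joint: "distributed M ?L Z (\<lambda>x. ennreal (sarmanov_pdf n k \<beta> Q \<alpha> x))"
    using model unfolding SME_def Z_def[abs_def] by (auto simp: components_def)
  interpret M: prob_space M by (rule M)
  interpret S: sarmanov_marginals n k \<beta> Q
    by standard (use n k comp scale_le in \<open>auto simp: components_def\<close>)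
  have rv: "X i j \<in> borel_measurable M" if "(i, j) \<in> ?C" for i j
    using comp[OF that] distributed_measurable by fastforce
  have X_nonneg: "AE \<omega> in M. 0 \<le> X i j \<omega>" if "(i, j) \<in> ?C" for i j
  proof (subst M.distributed_AE2[of lborel "X i j"])
    show "distributed M lborel (X i j) (\<lambda>x. ennreal (ME_pdf (\<beta> i j) (Q i j) x))" using comp[OF that] by simp
    show "AE x in lborel. 0 < ennreal (ME_pdf (\<beta> i j) (Q i j) x) \<longrightarrow> 0 \<le> x"
      by (rule AE_I2) (metis ME_pdf_neg ennreal_0 less_irrefl not_le)
  qed simp
  have C: "(i, j) \<in> ?C" if "i \<in> {1..n}" "j \<in> {1..k i}" for i j
    using that by (simp add: components_def)
  have portfolio: "portfolio_sum k X i \<omega> = S.portfolio i (Z \<omega>)" if "i \<in> {1..n}" for i \<omega>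
    unfolding portfolio_sum_def S.portfolio_def Z_def using C[OF that] by (intro sum.cong) auto
  have [measurable]: "portfolio_sum k X i \<in> borel_measurable M" if "i \<in> {1..n}" for i
    unfolding portfolio_sum_def[abs_def] using C[OF that] by (intro borel_measurable_sum rv) auto
  have [measurable]: "?T i \<in> borel_measurable M" if "i \<in> {1..n}" for i
    unfolding stop_loss_def[abs_def] using that by measurable
  have [measurable]: "?R \<in> borel_measurable M"
    unfolding total_loss_def[abs_def] by measurable
  have T_le_R: "?T l \<omega> \<le> ?R \<omega>" for \<omega>
    unfolding total_loss_def by (rule member_le_sum) (use l in \<open>auto simp: stop_loss_def\<close>)
  have xp0: "0 \<le> x\<^sub>p"
    unfolding x\<^sub>p by (rule VaR_nonneg[OF M _ _ p]) (auto simp: total_loss_def stop_loss_def intro!: sum_nonneg)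

  \<comment> \<open>On the event that the total loss is at most \<open>x\<^sub>p\<close>, the single loss is bounded by \<open>x\<^sub>p\<close>.\<close>
  have T_int: "integrable M (?T l)"
  proof -
    have "integrable M (\<lambda>\<omega>. ?T l \<omega> * of_bool (?R \<omega> \<le> x\<^sub>p))"
    proof (rule M.integrable_const_bound)
      show "AE \<omega> in M. norm (?T l \<omega> * of_bool (?R \<omega> \<le> x\<^sub>p)) \<le> x\<^sub>p"
        using T_le_R xp0 by (intro AE_I2) (auto simp: stop_loss_def intro: order_trans)
    qed (use l in measurable)
    from Bochner_Integration.integrable_add[OF expectation_exists this] show ?thesis
      by (rule Bochner_Integration.integrable_cong[OF refl, THEN iffD1, rotated])
         (simp add: tail_part_def x\<^sub>p of_bool_def)
  qed
  have X_int: "integrable M (X l j)" if j: "j \<in> {1..k l}" for j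
  proof (rule Bochner_Integration.integrable_bound)
    show "integrable M (\<lambda>\<omega>. ?T l \<omega> + d l)" using T_int by simp
    have "AE \<omega> in M. \<forall>j\<in>{1..k l}. 0 \<le> X l j \<omega>"
      using X_nonneg[OF C[OF l]] by (intro AE_finite_allI) auto
    then show "AE \<omega> in M. norm (X l j \<omega>) \<le> norm (?T l \<omega> + d l)"
    proof eventually_elim
      case (elim \<omega>)
      have "X l j \<omega> \<le> portfolio_sum k X l \<omega>"
        unfolding portfolio_sum_def using elim j by (intro member_le_sum) auto
      then show ?case using elim j d_pos[OF l] by (auto simp: stop_loss_def)
    qed
  qed (rule rv[OF C[OF l j]])
  have mean: "(\<integral>\<^sup>+t. ennreal (ME_pdf (\<beta> l j) (Q l j) t) * ennreal t \<partial>lborel) < \<infinity>" if j: "j \<in> {1..k l}" for j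
  proof -
    have "(\<integral>\<^sup>+t. ennreal (ME_pdf (\<beta> l j) (Q l j) t) * ennreal t \<partial>lborel) = (\<integral>\<^sup>+\<omega>. ennreal (X l j \<omega>) \<partial>M)"
      using comp[OF C[OF l j]] by (intro distributed_nn_integral) auto
    also have "\<dots> \<le> (\<integral>\<^sup>+\<omega>. ennreal (norm (X l j \<omega>)) \<partial>M)"
      by (intro nn_integral_mono ennreal_leI) simp
    also have "\<dots> < \<infinity>" using X_int[OF j] by (simp add: integrable_iff_bounded)
    finally show ?thesis .
  qed

  \<comment> \<open>The contribution of the set \<open>J\<close>, and the total contribution, of the product in which the
    densities of the components in \<open>A\<close> are squared.\<close>
  define u where "u A J = U B (mixS n k \<beta> Q A) J l x\<^sub>p d
      * (\<Prod>i\<in>{1..n} - insert l J. cdf (ME B (mixS n k \<beta> Q A i)) (d i))" for A J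
  define E where "E A = (LINT x|?L. squared_pdf n k \<beta> Q A x * S.tail_loss d l x\<^sub>p x)" for A
  have int_E: "integrable ?L (\<lambda>x. squared_pdf n k \<beta> Q A x * S.tail_loss d l x\<^sub>p x)"
    and E_u: "E A = (\<Sum>J\<in>Pow ({1..n} - {l}). u A J)" if "A \<subseteq> ?C" for A
    using S.squared_pdf_allocation[OF that l xp0 less_imp_le[OF d_pos] mean] by (simp_all add: E_def u_def B)

  define c where "c = (\<lambda>(a, b, s, t). \<alpha> a b s t * \<gamma> \<beta> Q a s * \<gamma> \<beta> Q b t)"
  define A1 A2 A3 :: "nat \<times> nat \<times> nat \<times> nat \<Rightarrow> (nat \<times> nat) set"
    where "A1 = (\<lambda>(a, b, s, t). {(a, s)})" and "A2 = (\<lambda>(a, b, s, t). {(b, t)})"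
      and "A3 = (\<lambda>(a, b, s, t). {(a, s), (b, t)})"
  have sub: "A1 z \<subseteq> ?C" "A2 z \<subseteq> ?C" "A3 z \<subseteq> ?C" if "z \<in> index_pairs n k" for z
    using that index_pairsD by (auto simp: A1_def A2_def A3_def)
  have pdf: "sarmanov_pdf n k \<beta> Q \<alpha> x = \<xi> n k \<beta> Q \<alpha> * squared_pdf n k \<beta> Q {} x
    - (\<Sum>z\<in>index_pairs n k. c z * (squared_pdf n k \<beta> Q (A1 z) x + squared_pdf n k \<beta> Q (A2 z) x
          - squared_pdf n k \<beta> Q (A3 z) x))" for x
    using sarmanov_pdf_eq_squared_pdf[of n k \<beta> Q \<alpha> x] S.\<gamma>_pos
    by (force simp: c_def A1_def A2_def A3_def case_prod_unfold)

  have pdf_nonneg: "0 \<le> sarmanov_pdf n k \<beta> Q \<alpha> x" for x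
  proof (cases "\<forall>c\<in>?C. 0 \<le> x c")
    case True
    then show ?thesis
      unfolding sarmanov_pdf_def using comp bracket[OF True] C
      by (intro mult_nonneg_nonneg prod_nonneg) (auto intro!: prod_nonneg ME_pdf_nonneg)
  next
    case False
    then obtain i j where ij: "i \<in> {1..n}" "j \<in> {1..k i}" "x (i, j) < 0"
      by (auto simp: components_def)
    then have "(\<Prod>j=1..k i. ME_pdf (\<beta> i j) (Q i j) (x (i, j))) = 0"
      by (intro prod_zero) (auto intro!: bexI[of _ j] simp: ME_pdf_neg)
    then have "(\<Prod>i=1..n. \<Prod>j=1..k i. ME_pdf (\<beta> i j) (Q i j) (x (i, j))) = 0"
      using ij by (intro prod_zero) auto
    then show ?thesis
      unfolding sarmanov_pdf_def by (simp only: mult_zero_left order_refl)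
  qed

  have "tail_part M p (?T l) ?R \<omega> = S.tail_loss d l x\<^sub>p (Z \<omega>)" for \<omega>
    unfolding tail_part_def S.tail_loss_def total_loss_def stop_loss_def x\<^sub>p[symmetric]
    using portfolio l x\<^sub>p by (simp add: total_loss_def stop_loss_def)
  then have "(LINT \<omega>|M. tail_part M p (?T l) ?R \<omega>) = (LINT \<omega>|M. S.tail_loss d l x\<^sub>p (Z \<omega>))"
    by simp
  also have "\<dots> = (LINT x|?L. sarmanov_pdf n k \<beta> Q \<alpha> x * S.tail_loss d l x\<^sub>p x)"
    by (rule distributed_integral[OF joint S.borel_measurable_tail_loss[OF l] pdf_nonneg, symmetric])
  also have "\<dots> = (LINT x|?L. \<xi> n k \<beta> Q \<alpha> * (squared_pdf n k \<beta> Q {} x * S.tail_loss d l x\<^sub>p x)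
      - (\<Sum>z\<in>index_pairs n k. c z * (squared_pdf n k \<beta> Q (A1 z) x * S.tail_loss d l x\<^sub>p x
          + squared_pdf n k \<beta> Q (A2 z) x * S.tail_loss d l x\<^sub>p x
          - squared_pdf n k \<beta> Q (A3 z) x * S.tail_loss d l x\<^sub>p x)))"
    unfolding pdf by (simp add: ring_distribs sum_distrib_left sum_distrib_right mult.assoc)
  also have "\<dots> = \<xi> n k \<beta> Q \<alpha> * E {} - (\<Sum>z\<in>index_pairs n k. c z * (E (A1 z) + E (A2 z) - E (A3 z)))"
    using sub int_E by (simp add: E_def)
  also have "\<dots> = (\<Sum>J\<in>Pow ({1..n} - {l}). \<xi> n k \<beta> Q \<alpha> * u {} J
      - (\<Sum>z\<in>index_pairs n k. c z * (u (A1 z) J + u (A2 z) J - u (A3 z) J)))"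
  proof -
    have "(\<Sum>z\<in>index_pairs n k. c z * (E (A1 z) + E (A2 z) - E (A3 z)))
        = (\<Sum>z\<in>index_pairs n k. \<Sum>J\<in>Pow ({1..n} - {l}). c z * (u (A1 z) J + u (A2 z) J - u (A3 z) J))"
      by (intro sum.cong refl)
         (simp add: sub E_u sum_distrib_left[symmetric] sum.distrib sum_subtractf)
    then show ?thesis
      by (subst (asm) sum.swap) (simp add: E_u sum_subtractf sum_distrib_left)
  qed
  also have "\<dots> = (\<Sum>m=0..n-1. \<Sum>J | J \<subseteq> {1..n} - {l} \<and> card J = m. \<xi> n k \<beta> Q \<alpha> * u {} J
      - (\<Sum>z\<in>index_pairs n k. c z * (u (A1 z) J + u (A2 z) J - u (A3 z) J)))"
    using l by (intro sum_Pow_card[symmetric]) auto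
  finally have "TVaR_alloc M p (?T l) ?R = 1 / (1 - p) *
      (\<Sum>m=0..n-1. \<Sum>J | J \<subseteq> {1..n} - {l} \<and> card J = m. \<xi> n k \<beta> Q \<alpha> * u {} J
      - (\<Sum>z\<in>index_pairs n k. c z * (u (A1 z) J + u (A2 z) J - u (A3 z) J)))"
    by (simp add: TVaR_alloc_def)
  moreover have "mixS1 n k \<beta> Q = mixS n k \<beta> Q {}" "mixS2 n k \<beta> Q a s = mixS n k \<beta> Q {(a, s)}"
    "mixS3 n k \<beta> Q a b s t = mixS n k \<beta> Q {(a, s), (b, t)}" for a b s t
    by (simp_all add: fun_eq_iff mixS1_def mixS2_def mixS3_def)
  ultimately show ?thesis
    unfolding sum_index_pairs
    by (simp add: u_def c_def A1_def A2_def A3_def case_prod_unfold mult.assoc)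
qed

end
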